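(* Let $\Gamma$ be a Fuchsian group of the first kind and let $h$ be a $\Gamma$-equivariant function different from the identity map $h_0(z)=z$ of $\mathbb{H}$. Then for any $z\in\widehat{\mathbb{C}}$, the set $h^{-1}(\{z\})$ contains infinitely many non $\Gamma$-equivalent points. In particular (for $z=\infty$), $h$ has infinitely many non $\Gamma$-equivalent poles in $\mathbb{H}$.
   Context: $\mathbb{H}$ is the upper half-plane and $\widehat{\mathbb{C}}=\mathbb{C}\cup\{\infty\}$. $\mathrm{PSL}_2(\mathbb{R})=\mathrm{SL}_2(\mathbb{R})/\{\pm I\}$ acts on $\widehat{\mathbb{C}}$ by Möbius transformations, preserving $\mathbb{H}$ and $\mathbb{R}\cup\{\infty\}$. A Fuchsian group is a discrete subgroup $\Gamma$ of $\mathrm{PSL}_2(\mathbb{R})$; its limit set $\Lambda(\Gamma)\subset\mathbb{R}\cup\{\infty\}$ is the set of all limit points of orbits $\Gamma z$, $z\in\mathbb{H}$; it is of the first kind if $\Lambda(\Gamma)=\mathbb{R}\cup\{\infty\}$. A $\Gamma$-equivariant function is a meromorphic function $h$ on $\mathbb{H}$ (viewed as a map $\mathbb{H}\to\widehat{\mathbb{C}}$) such that $h(\gamma z)=\gamma(h(z))$ for all $\gamma\in\Gamma$, $z\in\mathbb{H}$. Points $z,w$ are $\Gamma$-equivalent if $w=\gamma z$ for some $\gamma\in\Gamma$. *)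

theory Defs
  imports
    "HOL-Complex_Analysis.Complex_Analysis"
    "HOL-Algebra.Coset"
begin

section \<open>The Riemann sphere and the upper half-plane\<close>

text \<open>
  The Riemann sphere is the one-point compactification of the plane: \<open>None\<close> is the point at
  infinity and \<open>Some z\<close> is the finite point \<open>z\<close>.
\<close>

type_synonym riemann_sphere = "complex option"

abbreviation sphere_topology :: "riemann_sphere topology" where
  "sphere_topology \<equiv> Alexandroff_compactification euclidean"

definition upper_half_plane :: "complex set" where
  "upper_half_plane = {z. Im z > 0}"

definition extended_reals :: "riemann_sphere set" where
  "extended_reals = insert None (range (\<lambda>x::real. Some (complex_of_real x)))"

text \<open>
  The map to the Riemann sphere given by a meromorphic function \<open>f\<close>. It is used for functions that
  are \<open>nicely_meromorphic_on\<close> a domain; these carry the conventional value \<open>0\<close> at a pole and the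
  limit value everywhere else.
\<close>

definition sphere_map :: "(complex \<Rightarrow> complex) \<Rightarrow> complex \<Rightarrow> riemann_sphere" where
  "sphere_map f z = (if is_pole f z then None else Some (f z))"


section \<open>The topological group \<open>PSL\<^sub>2(\<real>)\<close>\<close>

definition SL2R :: "(real^2^2) monoid" where
  "SL2R = \<lparr>carrier = {A. det A = 1}, monoid.mult = (**), one = mat 1\<rparr>"

text \<open>The elements of the quotient group are the cosets \<open>{A, - A}\<close>.\<close>

definition PSL2R :: "(real^2^2) set monoid" where
  "PSL2R = SL2R Mod {mat 1, - mat 1}"

text \<open>
  The quotient topology: the union of a set of cosets is its preimage under the projection.
\<close>

definition PSL2R_topology :: "(real^2^2) set topology" where
  "PSL2R_topology =
     topology (\<lambda>U. U \<subseteq> carrier PSL2R \<and> openin (top_of_set (carrier SL2R)) (\<Union>U))"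

definition mobius :: "real^2^2 \<Rightarrow> riemann_sphere \<Rightarrow> riemann_sphere" where
  "mobius A x =
     (let a = complex_of_real (A$1$1); b = complex_of_real (A$1$2);
          c = complex_of_real (A$2$1); d = complex_of_real (A$2$2)
      in case x of
           None \<Rightarrow> if c = 0 then None else Some (a / c)
         | Some z \<Rightarrow> if c * z + d = 0 then None else Some (moebius a b c d z))"

text \<open>
  The action of a coset is the common value of the Moebius transformations of its two
  representatives; see \<open>psl_act_coset\<close> below.
\<close>

definition psl_act :: "(real^2^2) set \<Rightarrow> riemann_sphere \<Rightarrow> riemann_sphere" where
  "psl_act \<gamma> x = the_elem ((\<lambda>A. mobius A x) ` \<gamma>)"

text \<open>
  The induced action on points of the upper half-plane, where the value is always finite;
  see \<open>psl_act_upper_half_plane\<close> below.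
\<close>

definition psl_act_uhp :: "(real^2^2) set \<Rightarrow> complex \<Rightarrow> complex" where
  "psl_act_uhp \<gamma> z = the (psl_act \<gamma> (Some z))"


section \<open>Fuchsian groups and equivariant functions\<close>

definition fuchsian_group :: "(real^2^2) set set \<Rightarrow> bool" where
  "fuchsian_group \<Gamma> \<longleftrightarrow>
     subgroup \<Gamma> PSL2R \<and> subtopology PSL2R_topology \<Gamma> = discrete_topology \<Gamma>"

definition limit_set :: "(real^2^2) set set \<Rightarrow> riemann_sphere set" where
  "limit_set \<Gamma> =
     (\<Union>z\<in>upper_half_plane. sphere_topology derived_set_of ((\<lambda>\<gamma>. psl_act \<gamma> (Some z)) ` \<Gamma>))"

definition first_kind :: "(real^2^2) set set \<Rightarrow> bool" where
  "first_kind \<Gamma> \<longleftrightarrow> limit_set \<Gamma> = extended_reals"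

definition equivariant_function :: "(real^2^2) set set \<Rightarrow> (complex \<Rightarrow> complex) \<Rightarrow> bool" where
  "equivariant_function \<Gamma> h \<longleftrightarrow>
     h nicely_meromorphic_on upper_half_plane \<and>
     (\<forall>\<gamma>\<in>\<Gamma>. \<forall>z\<in>upper_half_plane.
        sphere_map h (psl_act_uhp \<gamma> z) = psl_act \<gamma> (sphere_map h z))"

definition equivalent_points :: "(real^2^2) set set \<Rightarrow> complex \<Rightarrow> complex \<Rightarrow> bool" where
  "equivalent_points \<Gamma> z w \<longleftrightarrow> (\<exists>\<gamma>\<in>\<Gamma>. w = psl_act_uhp \<gamma> z)"

definition infinitely_many_inequivalent :: "(real^2^2) set set \<Rightarrow> complex set \<Rightarrow> bool" where
  "infinitely_many_inequivalent \<Gamma> X \<longleftrightarrow>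
     (\<exists>S\<subseteq>X. infinite S \<and> pairwise (\<lambda>z w. \<not> equivalent_points \<Gamma> z w) S)"


section \<open>Well-definedness\<close>

lemma group_SL2R: "group SL2R"
proof (rule groupI)
  fix A assume "A \<in> carrier SL2R"
  then have d: "det A = 1" by (simp add: SL2R_def)
  then have "invertible A" by (simp add: invertible_det_nz)
  then obtain B where B: "B ** A = mat 1" unfolding invertible_def by blast
  then have "det B * det A = 1" by (metis det_I det_mul)
  with d B show "\<exists>B\<in>carrier SL2R. B \<otimes>\<^bsub>SL2R\<^esub> A = \<one>\<^bsub>SL2R\<^esub>"
    by (auto simp: SL2R_def)
qed (auto simp: SL2R_def det_mul matrix_mul_assoc)

lemma det_uminus_2: "det (- A :: real^2^2) = det A"
  by (simp add: det_2)

lemma matrix_mul_uminus_one: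
  "(- mat 1 :: real^2^2) ** A = - A" "A ** (- mat 1 :: real^2^2) = - A"
  by (simp_all add: vec_eq_iff matrix_matrix_mult_def mat_def forall_2 sum_2)

lemma coset_SL2R: "{mat 1, - mat 1} #>\<^bsub>SL2R\<^esub> A = {A, - A}"
  by (simp add: r_coset_def SL2R_def matrix_mul_uminus_one insert_commute)

lemma normal_pm_one: "{mat 1, - mat 1} \<lhd> SL2R"
proof -
  interpret group SL2R by (rule group_SL2R)
  have "subgroup {mat 1, - mat 1} SL2R"
  proof (rule subgroupI)
    fix A assume A: "A \<in> {mat 1, - mat 1 :: real^2^2}"
    have "inv\<^bsub>SL2R\<^esub> A = A"
      by (rule inv_equality) (use A in \<open>auto simp: SL2R_def matrix_mul_uminus_one det_uminus_2\<close>)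
    with A show "inv\<^bsub>SL2R\<^esub> A \<in> {mat 1, - mat 1}" by simp
  qed (auto simp: SL2R_def matrix_mul_uminus_one det_uminus_2)
  moreover have "A <#\<^bsub>SL2R\<^esub> {mat 1, - mat 1} = {A, - A}" for A
    by (simp add: l_coset_def SL2R_def matrix_mul_uminus_one insert_commute)
  ultimately show ?thesis
    by (intro normalI) (simp_all add: coset_SL2R)
qed

lemma group_PSL2R: "group PSL2R"
  unfolding PSL2R_def by (rule normal.factorgroup_is_group [OF normal_pm_one])

lemma carrier_PSL2R: "carrier PSL2R = (\<lambda>A. {A, - A}) ` carrier SL2R"
  by (auto simp: PSL2R_def FactGroup_def RCOSETS_def coset_SL2R)

lemma Union_PSL2R_subset: "U \<subseteq> carrier PSL2R \<Longrightarrow> \<Union>U \<subseteq> carrier SL2R"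
  by (auto simp: carrier_PSL2R SL2R_def det_uminus_2)

lemma Union_Int_PSL2R:
  assumes "U \<subseteq> carrier PSL2R" "V \<subseteq> carrier PSL2R"
  shows "\<Union>(U \<inter> V) = \<Union>U \<inter> \<Union>V"
proof
  show "\<Union>U \<inter> \<Union>V \<subseteq> \<Union>(U \<inter> V)"
  proof
    fix A assume "A \<in> \<Union>U \<inter> \<Union>V"
    then obtain P Q where PQ: "P \<in> U" "A \<in> P" "Q \<in> V" "A \<in> Q" by blast
    then have "P = {A, - A}" "Q = {A, - A}"
      using assms by (auto simp: carrier_PSL2R)
    with PQ show "A \<in> \<Union>(U \<inter> V)" by blast
  qed
qed blast

lemma openin_PSL2R_topology:
  "openin PSL2R_topology U \<longleftrightarrow>
     U \<subseteq> carrier PSL2R \<and> openin (top_of_set (carrier SL2R)) (\<Union>U)"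
proof -
  have "istopology (\<lambda>U. U \<subseteq> carrier PSL2R \<and> openin (top_of_set (carrier SL2R)) (\<Union>U))"
    unfolding istopology_def
  proof (intro conjI allI impI)
    fix \<K> :: "(real^2^2) set set set"
    assume *: "\<forall>K\<in>\<K>. K \<subseteq> carrier PSL2R \<and> openin (top_of_set (carrier SL2R)) (\<Union>K)"
    have eq: "\<Union>(\<Union>\<K>) = (\<Union>K\<in>\<K>. \<Union>K)" by blast
    show "openin (top_of_set (carrier SL2R)) (\<Union>(\<Union>\<K>))"
      unfolding eq using * by (intro openin_Union) auto
  qed (auto simp: Union_Int_PSL2R)
  then show ?thesis by (simp add: PSL2R_topology_def)
qed

lemma topspace_PSL2R_topology: "topspace PSL2R_topology = carrier PSL2R"
proof -
  have "\<Union>(carrier PSL2R) = carrier SL2R"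
    by (auto simp: carrier_PSL2R SL2R_def det_uminus_2)
  then have "openin PSL2R_topology (carrier PSL2R)"
    by (simp add: openin_PSL2R_topology)
  then show ?thesis
    by (meson openin_PSL2R_topology openin_subset openin_topspace subset_antisym)
qed

lemma quotient_map_PSL2R:
  "quotient_map (top_of_set (carrier SL2R)) PSL2R_topology
     (\<lambda>A. {mat 1, - mat 1} #>\<^bsub>SL2R\<^esub> A)"
  unfolding quotient_map_def
proof (intro conjI allI impI)
  fix U assume U: "U \<subseteq> topspace PSL2R_topology"
  have "{A \<in> carrier SL2R. {A, - A} \<in> U} = \<Union>U"
  proof
    show "\<Union>U \<subseteq> {A \<in> carrier SL2R. {A, - A} \<in> U}"
      using U by (auto simp: topspace_PSL2R_topology carrier_PSL2R SL2R_def det_uminus_2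
          insert_commute dest!: subsetD)
  qed blast
  then show "openin (top_of_set (carrier SL2R))
        {A \<in> topspace (top_of_set (carrier SL2R)). {mat 1, - mat 1} #>\<^bsub>SL2R\<^esub> A \<in> U} =
      openin PSL2R_topology U"
    using U by (simp add: coset_SL2R openin_PSL2R_topology topspace_PSL2R_topology)
qed (simp add: topspace_PSL2R_topology carrier_PSL2R coset_SL2R)

lemma mobius_uminus: "mobius (- A) x = mobius A x"
proof (cases x)
  case (Some z)
  have 1: "- (of_real (A$2$1) * z) - of_real (A$2$2) = - (of_real (A$2$1) * z + of_real (A$2$2))"
    and 2: "- (of_real (A$1$1) * z) - of_real (A$1$2) = - (of_real (A$1$1) * z + of_real (A$1$2))"
    by simp_all
  show ?thesis
    unfolding mobius_def moebius_def Let_def Some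
    by (simp add: 1 2 del: minus_add_distrib)
qed (simp add: mobius_def)

lemma psl_act_coset: "psl_act ({mat 1, - mat 1} #>\<^bsub>SL2R\<^esub> A) x = mobius A x"
  by (simp add: psl_act_def coset_SL2R mobius_uminus)

lemma psl_act_upper_half_plane:
  assumes "\<gamma> \<in> carrier PSL2R" "z \<in> upper_half_plane"
  shows "psl_act \<gamma> (Some z) = Some (psl_act_uhp \<gamma> z)" "psl_act_uhp \<gamma> z \<in> upper_half_plane"
proof -
  obtain A where A: "det A = 1" "\<gamma> = {A, - A}"
    using assms(1) by (auto simp: carrier_PSL2R SL2R_def)
  define a b c d where abcd: "a = A$1$1" "b = A$1$2" "c = A$2$1" "d = A$2$2"
  have det: "a * d - b * c = 1" using A(1) by (simp add: det_2 abcd)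
  have z: "Im z > 0" using assms(2) by (simp add: upper_half_plane_def)
  have nz: "of_real c * z + of_real d \<noteq> 0"
  proof
    assume 0: "of_real c * z + of_real d = 0"
    from arg_cong[OF 0, of Im] z have "c = 0" by simp
    with 0 det show False by simp
  qed
  let ?w = "moebius (of_real a) (of_real b) (of_real c) (of_real d) z"
  have act: "psl_act \<gamma> (Some z) = Some ?w"
    using nz psl_act_coset[of A "Some z"] by (simp add: A(2) coset_SL2R mobius_def abcd)
  then have uhp: "psl_act_uhp \<gamma> z = ?w" by (simp add: psl_act_uhp_def)
  from act uhp show "psl_act \<gamma> (Some z) = Some (psl_act_uhp \<gamma> z)" by simp
  let ?D = "(c * Re z + d)\<^sup>2 + (c * Im z)\<^sup>2"
  have D: "?D > 0"
    using nz by (auto simp: complex_eq_iff sum_power2_gt_zero_iff)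
  have "Im ?w = (a * d - b * c) * Im z / ?D"
    unfolding moebius_def by (simp add: Im_divide algebra_simps)
  with det D z have "Im ?w > 0" by simp
  then show "psl_act_uhp \<gamma> z \<in> upper_half_plane" by (simp add: uhp upper_half_plane_def)
qed

end

(*
If h takes a real value x at some point of the upper half-plane, then, being open there, it takes
every value near x. Every orbit of the group on the Riemann sphere accumulates at x, so infinitely
many points of the orbit of w are values of h near one point; moving the arguments back by the group
gives preimages of w, and proper discontinuity makes infinitely many of them inequivalent.

It remains to see that h takes a real value. Near a pole it does. Otherwise h maps the half-plane
into itself or into the lower half-plane. A self-map h not increasing hyperbolic distances and
commuting with the group has a bounded orbit, since the boundary limit of an unbounded orbit would
be fixed by the whole group. Minimising the displacement of h over the closure of that orbit yields
either a fixed point, and then infinitely many, or equality in the Schwarz-Pick lemma; in both cases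
h is the identity. In the lower half-plane case the same applies to the square of the conjugate of h.
*)

theory Submission
  imports Defs
begin

text \<open>The limit set is built from orbits of points of the half-plane, but \<open>w\<close> may
  be real or infinite. What transfers density to the boundary is that a determinant 1 matrix
  \<open>A\<close> cannot keep two given boundary points both far from \<open>act A \<i>\<close>:
  one of them lands within a constant times \<open>Im (act A \<i>)\<close>, the constant depending
  only on the pair. Hence the orbit of a boundary point comes close to every real \<open>x\<close>
  as soon as it contains a second point. So the central fact about the group is that it fixes no
  boundary point, stated as the absence of a common eigenvector; the boundedness of orbits of a
  self-map rests on the same fact.

  Equality in the Schwarz-Pick lemma is kept as a polynomial identity, because it has to be followed
  in the limit to boundary points, where \<open>h\<close> itself has no value.\<close>

no_notation fps_nth (infixl "$" 75)

section \<open>The Schwarz--Pick lemma\<close>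

text \<open>The link between the ratio \<open>cmod (z - w) / cmod (z - cnj w)\<close> and imaginary
  parts: it decides when the ratio is below 1, and later converts the ratio into
  \<open>hyp_gap\<close>.\<close>

lemma cmod_diff_cnj_squared:
  "(cmod (z - cnj w))\<^sup>2 = (cmod (z - w))\<^sup>2 + 4 * Im z * Im w"
  unfolding cmod_power2 by (simp add: power2_eq_square algebra_simps)

lemma upper_half_plane_neq_cnj:
  assumes "Im z > 0" "Im w > 0"
  shows "z \<noteq> cnj w"
  using assms by auto

lemma cayley_in_disc_iff:
  assumes "Im w > 0" "z \<noteq> cnj w"
  shows "cmod ((z - w) / (z - cnj w)) < 1 \<longleftrightarrow> Im z > 0"
proof -
  have "cmod ((z - w) / (z - cnj w)) < 1 \<longleftrightarrow> cmod (z - w) < cmod (z - cnj w)"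
    using assms by (simp add: norm_divide)
  also have "\<dots> \<longleftrightarrow> (cmod (z - w))\<^sup>2 < (cmod (z - cnj w))\<^sup>2"
    by (simp add: abs_le_square_iff linorder_not_le[symmetric] del: linorder_not_le)
  also have "\<dots> \<longleftrightarrow> Im z > 0"
    using assms by (simp add: cmod_diff_cnj_squared zero_less_mult_iff)
  finally show ?thesis .
qed

lemma cayley_inverse:
  fixes w u :: complex
  assumes "Im w > 0" "cmod u < 1"
  defines "z \<equiv> (w - cnj w * u) / (1 - u)"
  shows "(z - w) / (z - cnj w) = u" "Im z > 0"
proof -
  have u: "1 - u \<noteq> 0" using assms by auto
  have w: "w - cnj w \<noteq> 0" using assms by (auto simp: complex_eq_iff)
  have 1: "z - w = (w - cnj w) * u / (1 - u)" and 2: "z - cnj w = (w - cnj w) / (1 - u)"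
    using u by (simp_all add: z_def field_simps)
  show eq: "(z - w) / (z - cnj w) = u"
    unfolding 1 2 using u w by (simp del: right_minus_eq)
  have "z \<noteq> cnj w" using 2 u w by auto
  then show "Im z > 0" using cayley_in_disc_iff[of w z] assms(1,2) eq by simp
qed

text \<open>Cayley transforms centred at \<open>w\<close> and at \<open>f w\<close> turn
  \<open>f\<close> into a self-map of the unit disc fixing 0, to which the Schwarz lemma applies.
  Clearing denominators leaves identities that survive passage to the boundary.\<close>

lemma upper_half_plane_Schwarz_Pick:
  assumes holo: "f holomorphic_on {z. Im z > 0}"
    and maps: "\<And>z. Im z > 0 \<Longrightarrow> Im (f z) > 0"
    and w: "Im w > 0"
  shows "Im z > 0 \<Longrightarrow> cmod (f z - f w) * cmod (z - cnj w) \<le> cmod (z - w) * cmod (f z - cnj (f w))"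
    and "Im z > 0 \<Longrightarrow> z \<noteq> w \<Longrightarrow>
           cmod (f z - f w) * cmod (z - cnj w) = cmod (z - w) * cmod (f z - cnj (f w)) \<Longrightarrow>
         \<exists>\<alpha>. \<forall>\<zeta>. Im \<zeta> > 0 \<longrightarrow> (f \<zeta> - f w) * (\<zeta> - cnj w) = \<alpha> * (\<zeta> - w) * (f \<zeta> - cnj (f w))"
proof -
  define C where "C p z = (z - p) / (z - cnj p)" for p z :: complex
  define D where "D u = (w - cnj w * u) / (1 - u)" for u :: complex
  define F where "F u = C (f w) (f (D u))" for u
  have D: "C w (D u) = u" "Im (D u) > 0" if "cmod u < 1" for u
    using cayley_inverse[OF w that] by (simp_all add: C_def D_def)
  have CD: "D (C w z) = z" if "Im z > 0" for z
  proof -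
    have "z - cnj w \<noteq> 0" using that w by auto
    moreover have "w - cnj w \<noteq> 0" using w by (auto simp: complex_eq_iff)
    moreover from calculation have "1 - C w z = (w - cnj w) / (z - cnj w)"
      "w - cnj w * C w z = (w - cnj w) * z / (z - cnj w)"
      by (simp_all add: C_def field_simps)
    ultimately show ?thesis by (simp add: D_def)
  qed
  have C1: "cmod (C p z) < 1" if "Im p > 0" "Im z > 0" for p z
    using that cayley_in_disc_iff[of p z] upper_half_plane_neq_cnj[of z p] by (simp add: C_def)
  have holF: "F holomorphic_on ball 0 1"
  proof -
    have "(\<lambda>u. f (D u)) holomorphic_on ball 0 1"
    proof (rule holomorphic_on_compose_gen[OF _ holo, unfolded o_def])
      show "D holomorphic_on ball 0 1"
        unfolding D_def by (intro holomorphic_intros) auto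
      show "D ` ball 0 1 \<subseteq> {z. Im z > 0}" using D by auto
    qed
    moreover have "f (D u) - cnj (f w) \<noteq> 0" if "u \<in> ball 0 1" for u
      using upper_half_plane_neq_cnj[OF maps[OF D(2)] maps[OF w], of u] that by simp
    ultimately show ?thesis
      unfolding F_def C_def by (intro holomorphic_intros) auto
  qed
  have F0: "F 0 = 0" by (simp add: F_def D_def C_def)
  have F1: "cmod (F u) < 1" if "cmod u < 1" for u
    unfolding F_def by (intro C1 maps w D that)
  have FC: "F (C w z) = C (f w) (f z)" if "Im z > 0" for z
    using CD[OF that] by (simp add: F_def)
  have nz: "z - cnj w \<noteq> 0" "f z - cnj (f w) \<noteq> 0" if "Im z > 0" for z
    using that w upper_half_plane_neq_cnj maps by auto
  { assume z: "Im z > 0"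
    have "cmod (C (f w) (f z)) \<le> cmod (C w z)"
      using Schwarz_Lemma(1)[OF holF F0 F1 C1[OF w z]] FC[OF z] by simp
    then show "cmod (f z - f w) * cmod (z - cnj w) \<le> cmod (z - w) * cmod (f z - cnj (f w))"
      using nz[OF z] by (simp add: C_def norm_divide field_simps) }
  { assume z: "Im z > 0" "z \<noteq> w"
      and eq: "cmod (f z - f w) * cmod (z - cnj w) = cmod (z - w) * cmod (f z - cnj (f w))"
    have "cmod (F (C w z)) = cmod (C w z)"
      using nz[OF z(1)] eq unfolding FC[OF z(1)]
      by (simp add: C_def norm_divide field_simps)
    moreover have "C w z \<noteq> 0" using nz[OF z(1)] z by (simp add: C_def)
    ultimately obtain \<alpha> where \<alpha>: "\<And>u. cmod u < 1 \<Longrightarrow> F u = \<alpha> * u"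
      using Schwarz_Lemma(3)[OF holF F0 F1, of 0] C1[OF w z(1)] by auto
    have "(f \<zeta> - f w) * (\<zeta> - cnj w) = \<alpha> * (\<zeta> - w) * (f \<zeta> - cnj (f w))" if "Im \<zeta> > 0" for \<zeta>
      using \<alpha>[OF C1[OF w that], unfolded FC[OF that]] nz[OF that]
      by (simp add: C_def field_simps)
    then show "\<exists>\<alpha>. \<forall>\<zeta>. Im \<zeta> > 0 \<longrightarrow> (f \<zeta> - f w) * (\<zeta> - cnj w) = \<alpha> * (\<zeta> - w) * (f \<zeta> - cnj (f w))"
      by blast }
qed

section \<open>Matrices acting on the half-plane\<close>

lemma matrix_mult_2:
  fixes A B :: "'a::semiring_1^2^2"
  shows "(A ** B)$i$j = A$i$1 * B$1$j + A$i$2 * B$2$j"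
  by (simp add: matrix_matrix_mult_def sum_2)

lemma matrix_vector_mult_2:
  fixes A :: "'a::semiring_1^2^2"
  shows "(A *v v)$i = A$i$1 * v$1 + A$i$2 * v$2"
  by (simp add: matrix_vector_mult_def sum_2)

lemma mat_1_2 [simp]:
  "(mat 1 :: real^2^2)$1$1 = 1" "(mat 1 :: real^2^2)$1$2 = 0"
  "(mat 1 :: real^2^2)$2$1 = 0" "(mat 1 :: real^2^2)$2$2 = 1"
  by (simp_all add: mat_def)

lemma matrix_eq_2:
  "A = B \<longleftrightarrow> A$1$1 = B$1$1 \<and> A$1$2 = B$1$2 \<and> A$2$1 = B$2$1 \<and> A$2$2 = B$2$2"
  for A B :: "'a^2^2"
  by (simp only: vec_eq_iff forall_2) (simp only: conj_assoc)

definition adjugate :: "real^2^2 \<Rightarrow> real^2^2" where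
  "adjugate A = vector [vector [A$2$2, - A$1$2], vector [- A$2$1, A$1$1]]"

lemma adjugate_nth [simp]:
  "adjugate A$1$1 = A$2$2" "adjugate A$1$2 = - A$1$2"
  "adjugate A$2$1 = - A$2$1" "adjugate A$2$2 = A$1$1"
  by (simp_all add: adjugate_def)

lemma adjugate_mult:
  assumes "det A = 1"
  shows "A ** adjugate A = mat 1" "adjugate A ** A = mat 1"
  using assms by (simp_all add: matrix_eq_2 matrix_mult_2 det_2 algebra_simps)

lemma det_adjugate [simp]: "det (adjugate A) = det A"
  by (simp add: det_2)

definition den :: "real^2^2 \<Rightarrow> complex \<Rightarrow> complex" where
  "den A z = of_real (A$2$1) * z + of_real (A$2$2)"

text \<open>The Moebius action on finite points, with \<open>den\<close> as its automorphy factor.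
  At a zero of \<open>den\<close> the value is the default 0 instead of infinity, so most facts
  assume \<open>den A z \<noteq> 0\<close> or a nonreal point.\<close>

definition act :: "real^2^2 \<Rightarrow> complex \<Rightarrow> complex" where
  "act A z = (of_real (A$1$1) * z + of_real (A$1$2)) / den A z"

text \<open>The zeros of \<open>fixform A\<close> are the finite fixed points of \<open>act A\<close>, and \<open>cmod (fixform A z) / Im z\<close>
  measures the hyperbolic displacement of \<open>z\<close> under \<open>A\<close>.\<close>

definition fixform :: "real^2^2 \<Rightarrow> complex \<Rightarrow> complex" where
  "fixform A z = of_real (A$2$1) * z\<^sup>2 + of_real (A$2$2 - A$1$1) * z - of_real (A$1$2)"

lemma den_nonzero:
  assumes "det A = 1" "Im z \<noteq> 0"
  shows "den A z \<noteq> 0"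
proof
  assume 0: "den A z = 0"
  from arg_cong[OF 0, of Im] assms(2) have "A$2$1 = 0" by (simp add: den_def)
  with 0 assms(1) show False by (simp add: den_def det_2)
qed

lemma act_times_den: "den A z \<noteq> 0 \<Longrightarrow> act A z * den A z = of_real (A$1$1) * z + of_real (A$1$2)"
  by (simp add: act_def)

text \<open>One identity serves two purposes: \<open>w = cnj z\<close> yields the imaginary part of
  \<open>act A z\<close>, and general \<open>w\<close> controls how distances shrink.\<close>

lemma act_diff:
  assumes "det A = 1" "den A z \<noteq> 0" "den A w \<noteq> 0"
  shows "act A z - act A w = (z - w) / (den A z * den A w)"
proof -
  have d: "of_real (A$1$1) * of_real (A$2$2) - of_real (A$1$2) * of_real (A$2$1) = (1::complex)"
    using arg_cong[OF assms(1), of complex_of_real] by (simp add: det_2)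
  have "(act A z - act A w) * (den A z * den A w) =
     (act A z * den A z) * den A w - (act A w * den A w) * den A z" by (simp add: algebra_simps)
  also have "\<dots> = z - w"
    unfolding act_times_den[OF assms(2)] act_times_den[OF assms(3)]
    unfolding den_def using d by algebra
  finally show ?thesis using assms by (simp add: field_simps)
qed

lemma act_cnj: "act A (cnj z) = cnj (act A z)" and den_cnj: "den A (cnj z) = cnj (den A z)"
  by (simp_all add: act_def den_def)

lemma Im_act:
  assumes "det A = 1" "Im z \<noteq> 0"
  shows "Im (act A z) = Im z / (cmod (den A z))\<^sup>2"
proof -
  have n: "den A z \<noteq> 0" "den A (cnj z) \<noteq> 0" using assms den_nonzero by auto
  have "act A z - cnj (act A z) = (z - cnj z) / (den A z * cnj (den A z))"
    using act_diff[OF assms(1) n] by (simp add: act_cnj den_cnj)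
  also have "den A z * cnj (den A z) = of_real ((cmod (den A z))\<^sup>2)"
    by (rule complex_norm_square[symmetric])
  finally have "Im (act A z - cnj (act A z)) = Im (z - cnj z) / (cmod (den A z))\<^sup>2"
    by (simp only: Im_divide_of_real)
  then show ?thesis by simp
qed

lemma Im_act_pos: "det A = 1 \<Longrightarrow> Im z > 0 \<Longrightarrow> Im (act A z) > 0"
  using den_nonzero[of A z] by (simp add: Im_act)

lemma Im_act_nonzero: "det A = 1 \<Longrightarrow> Im z \<noteq> 0 \<Longrightarrow> Im (act A z) \<noteq> 0"
  using den_nonzero[of A z] by (simp add: Im_act)

lemma act_minus_self:
  assumes "den A z \<noteq> 0"
  shows "act A z - z = - fixform A z / den A z"
  using assms unfolding act_def fixform_def
  by (simp add: field_simps) (simp add: den_def power2_eq_square algebra_simps)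

lemma den_mult:
  assumes "den B z \<noteq> 0"
  shows "den (A ** B) z = den A (act B z) * den B z"
proof -
  have "den A (act B z) * den B z = of_real (A$2$1) * (act B z * den B z) + of_real (A$2$2) * den B z"
    by (simp add: den_def algebra_simps)
  also have "\<dots> = den (A ** B) z"
    unfolding act_times_den[OF assms] by (simp add: den_def matrix_mult_2 algebra_simps)
  finally show ?thesis by simp
qed

lemma act_mult:
  assumes "den B z \<noteq> 0"
  shows "act (A ** B) z = act A (act B z)"
proof -
  have "(of_real (A$1$1) * act B z + of_real (A$1$2)) * den B z =
      of_real (A$1$1) * (act B z * den B z) + of_real (A$1$2) * den B z"
    by (simp add: algebra_simps)
  also have "\<dots> = of_real ((A ** B)$1$1) * z + of_real ((A ** B)$1$2)"
    unfolding act_times_den[OF assms] by (simp add: den_def matrix_mult_2 algebra_simps)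
  finally show ?thesis
    unfolding act_def[of "A ** B"] act_def[of A] den_mult[OF assms]
    using assms by (metis nonzero_mult_divide_mult_cancel_right)
qed

lemma act_mat_1 [simp]: "act (mat 1) z = z"
  by (simp add: act_def den_def)

lemma act_adjugate:
  assumes "det A = 1" "Im z \<noteq> 0"
  shows "act (adjugate A) (act A z) = z" "act A (act (adjugate A) z) = z"
  using assms by (simp_all add: act_mult[symmetric] den_nonzero adjugate_mult)

text \<open>A matrix commuting with \<open>A0\<close> permutes the fixed points of
  \<open>A0\<close>, so the quadratic polynomial having them as roots is merely rescaled, by the
  square of the automorphy factor.\<close>

lemma fixform_act:
  assumes "A0 ** A = A ** A0" "det A = 1" "den A z \<noteq> 0"
  shows "fixform A0 (act A z) * (den A z)\<^sup>2 = fixform A0 z"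
proof -
  have e: "of_real (A0$i$1) * of_real (A$1$j) + of_real (A0$i$2) * of_real (A$2$j) =
      (of_real (A$i$1) * of_real (A0$1$j) + of_real (A$i$2) * of_real (A0$2$j) :: complex)" for i j
    using arg_cong[OF assms(1), of "\<lambda>M. complex_of_real (M$i$j)"] by (simp add: matrix_mult_2)
  have d: "of_real (A$1$1) * of_real (A$2$2) - of_real (A$1$2) * of_real (A$2$1) = (1::complex)"
    using arg_cong[OF assms(2), of complex_of_real] by (simp add: det_2)
  have "fixform A0 (act A z) * (den A z)\<^sup>2 = of_real (A0$2$1) * (act A z * den A z)\<^sup>2 +
     of_real (A0$2$2 - A0$1$1) * (act A z * den A z) * den A z - of_real (A0$1$2) * (den A z)\<^sup>2"
    by (simp add: fixform_def power2_eq_square algebra_simps)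
  also have "\<dots> = fixform A0 z"
    unfolding act_times_den[OF assms(3)]
    unfolding fixform_def den_def of_real_diff
    using e[of 1 1] e[of 1 2] e[of 2 1] e[of 2 2] d by algebra
  finally show ?thesis .
qed

text \<open>The quotient \<open>cmod (den A z) / cmod (den A w)\<close> is bounded independently of
  \<open>A\<close>. By \<open>act_diff\<close> the images are therefore at a distance of order
  \<open>Im (act A z)\<close>, which is at most the distance of \<open>act A z\<close> from any real
  \<open>x\<close>.\<close>

lemma act_close:
  assumes A: "det A = 1" and w: "Im w \<noteq> 0" and z: "Im z > 0"
  shows "cmod (act A w - act A z) \<le>
    cmod (w - z) * (1 + cmod (w - z) / \<bar>Im w\<bar>) / Im z * cmod (act A z - of_real x)"
proof -
  have nz: "den A z \<noteq> 0" "den A w \<noteq> 0" using assms den_nonzero by auto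
  have "\<bar>A$2$1\<bar> * \<bar>Im w\<bar> = \<bar>Im (den A w)\<bar>" by (simp add: den_def abs_mult)
  also have "\<dots> \<le> cmod (den A w)" by (rule abs_Im_le_cmod)
  finally have "\<bar>A$2$1\<bar> \<le> cmod (den A w) / \<bar>Im w\<bar>" using w by (simp add: field_simps)
  then have "\<bar>A$2$1\<bar> * cmod (w - z) \<le> cmod (den A w) / \<bar>Im w\<bar> * cmod (w - z)"
    by (intro mult_right_mono) auto
  moreover have "den A z = den A w - of_real (A$2$1) * (w - z)"
    by (simp add: den_def algebra_simps)
  then have "cmod (den A z) \<le> cmod (den A w) + \<bar>A$2$1\<bar> * cmod (w - z)"
    by (metis norm_triangle_ineq4 norm_mult norm_of_real)
  ultimately have le: "cmod (den A z) \<le> cmod (den A w) * (1 + cmod (w - z) / \<bar>Im w\<bar>)"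
    by (simp add: algebra_simps)
  have "cmod (act A w - act A z) = cmod (w - z) / (cmod (den A w) * cmod (den A z))"
    using act_diff[OF A nz(2) nz(1)] by (simp add: norm_divide norm_mult)
  also have "\<dots> = cmod (w - z) * cmod (den A z) / (cmod (den A w) * (cmod (den A z))\<^sup>2)"
    using nz by (simp add: power2_eq_square)
  also have "\<dots> \<le> cmod (w - z) * (cmod (den A w) * (1 + cmod (w - z) / \<bar>Im w\<bar>)) /
      (cmod (den A w) * (cmod (den A z))\<^sup>2)"
    by (intro divide_right_mono mult_left_mono le) auto
  also have "\<dots> = cmod (w - z) * (1 + cmod (w - z) / \<bar>Im w\<bar>) / Im z * Im (act A z)"
    using nz z A by (simp add: Im_act)
  also have "\<dots> \<le> cmod (w - z) * (1 + cmod (w - z) / \<bar>Im w\<bar>) / Im z * cmod (act A z - of_real x)"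
    using z abs_Im_le_cmod[of "act A z - of_real x"] by (intro mult_left_mono) auto
  finally show ?thesis .
qed

lemma abs_matrix_nth_le_norm: "\<bar>M$i$j\<bar> \<le> norm M" for M :: "real^'n^'m"
  by (rule order_trans[OF component_le_norm_cart Finite_Cartesian_Product.norm_nth_le])

section \<open>Orbits of a discrete group with limit set the real line\<close>

text \<open>The group is represented by matrices instead of cosets. \<open>finite_bounded\<close>
  expresses discreteness. In \<open>limit_point\<close> the orbit points are nonreal, so coming
  arbitrarily close to \<open>x\<close> already means accumulating there.\<close>

locale first_kind_matrix_group =
  fixes G :: "(real^2^2) set"
  assumes det: "A \<in> G \<Longrightarrow> det A = 1"
    and mult_closed: "A \<in> G \<Longrightarrow> B \<in> G \<Longrightarrow> A ** B \<in> G"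
    and adjugate_closed: "A \<in> G \<Longrightarrow> adjugate A \<in> G"
    and finite_bounded: "finite {A \<in> G. \<forall>i j. \<bar>A$i$j\<bar> \<le> R}"
    and limit_point: "\<exists>z. Im z > 0 \<and> (\<forall>e>0. \<exists>A\<in>G. cmod (act A z - of_real x) < e)"
begin

text \<open>The sequence does not depend on \<open>w\<close>: by \<open>act_close\<close> it carries
  all nonreal points, in either half-plane, to the same \<open>x\<close>. This is what later makes a
  point and its value under \<open>h\<close> converge together.\<close>

lemma exhausting_sequence:
  fixes x :: real
  obtains A where "\<And>n. A n \<in> G" "\<And>w. Im w \<noteq> 0 \<Longrightarrow> (\<lambda>n. act (A n) w) \<longlonglongrightarrow> of_real x"
proof -
  obtain z where z: "Im z > 0" "\<And>e. e > 0 \<Longrightarrow> \<exists>A\<in>G. cmod (act A z - of_real x) < e"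
    using limit_point[of x] by blast
  have "\<forall>n. \<exists>A\<in>G. cmod (act A z - of_real x) < inverse (real (Suc n))"
    using z(2) by simp
  then obtain A where A: "\<And>n. A n \<in> G" "\<And>n. cmod (act (A n) z - of_real x) < inverse (real (Suc n))"
    by metis
  have lim: "(\<lambda>n. cmod (act (A n) z - of_real x)) \<longlonglongrightarrow> 0"
    by (rule tendsto_sandwich[OF _ _ tendsto_const LIMSEQ_inverse_real_of_nat])
       (auto intro!: always_eventually less_imp_le[OF A(2)] simp del: of_nat_Suc)
  show ?thesis
  proof (rule that[of A])
    fix w assume w: "Im w \<noteq> 0"
    define K where "K = cmod (w - z) * (1 + cmod (w - z) / \<bar>Im w\<bar>) / Im z"
    have "cmod (act (A n) w - of_real x) \<le> (K + 1) * cmod (act (A n) z - of_real x)" for n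
      using act_close[OF det[OF A(1)] w z(1), of n x]
        norm_triangle_ineq[of "act (A n) w - act (A n) z" "act (A n) z - of_real x"]
      by (simp add: K_def algebra_simps)
    then have "(\<lambda>n. act (A n) w - of_real x) \<longlonglongrightarrow> 0"
      by (intro Lim_null_comparison[OF always_eventually tendsto_mult_right_zero[OF lim]]) auto
    then show "(\<lambda>n. act (A n) w) \<longlonglongrightarrow> of_real x" by (simp add: LIM_zero_iff)
  qed (rule A(1))
qed

lemma infinite_orbit_near_nonreal:
  assumes "Im w \<noteq> 0" "e > 0"
  shows "infinite ((\<lambda>A. act A w) ` G \<inter> ball (of_real x) e)"
proof -
  obtain A where A: "\<And>n. A n \<in> G" "\<And>w. Im w \<noteq> 0 \<Longrightarrow> (\<lambda>n. act (A n) w) \<longlonglongrightarrow> of_real x"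
    using exhausting_sequence by blast
  have "act (A n) w \<noteq> of_real x" for n
    using Im_act_nonzero[OF det[OF A(1)] assms(1), of n] by auto
  then have "of_real x islimpt (\<lambda>A. act A w) ` G"
    unfolding islimpt_sequential using A assms(1) by (intro exI[of _ "\<lambda>n. act (A n) w"]) auto
  then show ?thesis using assms(2) by (simp add: islimpt_eq_infinite_ball)
qed

text \<open>By \<open>fixform_act\<close> the modulus of \<open>fixform A0\<close> divided by the
  imaginary part is constant along the orbit of \<open>\<i>\<close>. Letting the orbit approach a
  real \<open>x\<close> shows that this quadratic polynomial vanishes at every real number.\<close>

lemma central_scalar:
  assumes "\<And>A. A \<in> G \<Longrightarrow> A0 ** A = A ** A0"
  shows "A0$2$1 = 0" "A0$1$2 = 0" "A0$1$1 = A0$2$2"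
proof -
  have zero: "fixform A0 (of_real x) = 0" for x
  proof -
    obtain A where A: "\<And>n. A n \<in> G" "\<And>w. Im w \<noteq> 0 \<Longrightarrow> (\<lambda>n. act (A n) w) \<longlonglongrightarrow> of_real x"
      using exhausting_sequence by blast
    have lim: "(\<lambda>n. act (A n) \<i>) \<longlonglongrightarrow> of_real x" using A(2) by simp
    have eq: "cmod (fixform A0 (act (A n) \<i>)) = cmod (fixform A0 \<i>) * Im (act (A n) \<i>)" for n
    proof -
      have nz: "den (A n) \<i> \<noteq> 0" by (intro den_nonzero det A) simp
      have "cmod (fixform A0 (act (A n) \<i>)) * (cmod (den (A n) \<i>))\<^sup>2 = cmod (fixform A0 \<i>)"
        using arg_cong[OF fixform_act[OF assms[OF A(1)] det[OF A(1)] nz], of cmod]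
        by (simp add: norm_mult norm_power)
      then show ?thesis using nz by (simp add: Im_act det A(1) field_simps)
    qed
    have "(\<lambda>n. cmod (fixform A0 \<i>) * Im (act (A n) \<i>)) \<longlonglongrightarrow> cmod (fixform A0 \<i>) * Im (of_real x)"
      by (intro tendsto_intros lim)
    moreover have "(\<lambda>n. cmod (fixform A0 (act (A n) \<i>))) \<longlonglongrightarrow> cmod (fixform A0 (of_real x))"
      unfolding fixform_def by (intro tendsto_intros lim)
    ultimately have "cmod (fixform A0 (of_real x)) = cmod (fixform A0 \<i>) * Im (of_real x)"
      unfolding eq using LIMSEQ_unique by blast
    then show ?thesis by simp
  qed
  have z: "A0$2$1 * x\<^sup>2 + (A0$2$2 - A0$1$1) * x - A0$1$2 = 0" for x
    using arg_cong[OF zero[of x], of Re] by (simp add: fixform_def power2_eq_square)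
  show "A0$1$2 = 0" using z[of 0] by simp
  then show "A0$2$1 = 0" "A0$1$1 = A0$2$2" using z[of 1] z[of "-1"] by simp_all
qed

text \<open>In a commutative group \<open>central_scalar\<close> would apply to every element, so
  all of them would fix \<open>\<i>\<close>, whose orbit however approaches 0.\<close>

lemma noncommutative: "\<exists>A\<in>G. \<exists>B\<in>G. A ** B \<noteq> B ** A"
proof (rule ccontr)
  assume "\<not> ?thesis"
  then have c: "A ** B = B ** A" if "A \<in> G" "B \<in> G" for A B using that by blast
  obtain A where A: "\<And>n. A n \<in> G" "\<And>w. Im w \<noteq> 0 \<Longrightarrow> (\<lambda>n. act (A n) w) \<longlonglongrightarrow> of_real 0"
    using exhausting_sequence[of 0] by blast
  have "act (A n) \<i> = \<i>" for n
  proof -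
    have s: "A n$2$1 = 0" "A n$1$2 = 0" "A n$1$1 = A n$2$2"
      by (rule central_scalar[OF c[OF A(1)]]; assumption)+
    moreover have "A n$2$2 \<noteq> 0" using s det[OF A(1), of n] by (auto simp: det_2)
    ultimately show ?thesis by (simp add: act_def den_def)
  qed
  then have "(\<lambda>n. \<i>) \<longlonglongrightarrow> of_real 0" using A(2)[of \<i>] by simp
  then show False using LIMSEQ_unique[OF tendsto_const] by fastforce
qed

end

section \<open>Unipotent matrices fixing a vector\<close>

text \<open>The product of the column \<open>v\<close> with the row \<open>(- v$2, v$1)\<close>: for
  nonzero \<open>v\<close> a nilpotent matrix whose kernel and image are both spanned by
  \<open>v\<close>. The matrices \<open>mat 1 + t *\<^sub>R nilp v\<close> are then the determinant
  1 matrices fixing \<open>v\<close>.\<close>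

definition nilp :: "real^2 \<Rightarrow> real^2^2" where
  "nilp v = vector [vector [- v$1 * v$2, v$1 * v$1], vector [- v$2 * v$2, v$1 * v$2]]"

lemma nilp_nth [simp]:
  "nilp v$1$1 = - v$1 * v$2" "nilp v$1$2 = v$1 * v$1"
  "nilp v$2$1 = - v$2 * v$2" "nilp v$2$2 = v$1 * v$2"
  by (simp_all add: nilp_def)

lemma vec2_nonzero: "v \<noteq> 0 \<Longrightarrow> v$1 \<noteq> 0 \<or> v$2 \<noteq> 0" for v :: "real^2"
  by (auto simp: vec_eq_iff forall_2)

lemma unipotent_entries:
  fixes a b c d x y :: real
  assumes "a * x + b * y = x" "c * x + d * y = y" "a * d - b * c = 1" "x \<noteq> 0"
  shows "\<exists>t. b = t * (x * x) \<and> a = 1 - t * (x * y) \<and> d = 1 + t * (x * y) \<and> c = - (t * (y * y))"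
proof -
  define t where "t = b / (x * x)"
  have t: "b = t * (x * x)" using assms by (simp add: t_def)
  have ax: "a * x = (1 - t * (x * y)) * x" using assms(1) unfolding t by (simp add: algebra_simps)
  have cx: "c * x = y - d * y" using assms(2) by simp
  have "x = (a * d - b * c) * x" using assms(3) by simp
  also have "\<dots> = d * (a * x) - b * (c * x)" by (simp add: algebra_simps)
  also have "\<dots> = (d - t * (x * y)) * x" unfolding ax cx t by (simp add: algebra_simps)
  finally have d: "d = 1 + t * (x * y)" using assms(4) by simp
  have "c * x = - (t * (y * y)) * x" unfolding cx d by (simp add: algebra_simps)
  then have "c = - (t * (y * y))" using mult_right_cancel[OF assms(4)] by blast
  moreover have "a = 1 - t * (x * y)" using ax assms(4) by simp
  ultimately show ?thesis using t d by blast
qed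

lemma fixing_vector_unipotent:
  assumes "det C = 1" "C *v v = v" "v \<noteq> 0"
  obtains t where "C = mat 1 + t *\<^sub>R nilp v"
proof -
  have e: "C$1$1 * v$1 + C$1$2 * v$2 = v$1" "C$2$1 * v$1 + C$2$2 * v$2 = v$2"
    using arg_cong[OF assms(2), of "\<lambda>u. u$1"] arg_cong[OF assms(2), of "\<lambda>u. u$2"]
    by (simp_all add: matrix_vector_mult_2)
  have d: "C$1$1 * C$2$2 - C$1$2 * C$2$1 = 1" using assms(1) by (simp add: det_2)
  consider "v$1 \<noteq> 0" | "v$2 \<noteq> 0" using vec2_nonzero[OF assms(3)] by blast
  then show ?thesis
  proof cases
    case 1
    from unipotent_entries[OF e d 1] obtain t where
      "C$1$2 = t * (v$1 * v$1)" "C$1$1 = 1 - t * (v$1 * v$2)"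
      "C$2$2 = 1 + t * (v$1 * v$2)" "C$2$1 = - (t * (v$2 * v$2))" by blast
    then show ?thesis
      by (intro that[of t]) (simp add: matrix_eq_2)
  next
    case 2
    \<comment> \<open>The same computation with the coordinates exchanged. The exchange turns
      \<open>nilp v\<close> into its negative, hence the parameter \<open>- t\<close> below.\<close>
    have "C$2$2 * v$2 + C$2$1 * v$1 = v$2" "C$1$2 * v$2 + C$1$1 * v$1 = v$1"
      "C$2$2 * C$1$1 - C$2$1 * C$1$2 = 1"
      using e d by (simp_all add: algebra_simps)
    from unipotent_entries[OF this 2] obtain t where
      "C$2$1 = t * (v$2 * v$2)" "C$2$2 = 1 - t * (v$2 * v$1)"
      "C$1$1 = 1 + t * (v$2 * v$1)" "C$1$2 = - (t * (v$1 * v$1))" by blast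
    then show ?thesis
      by (intro that[of "- t"]) (simp add: matrix_eq_2)
  qed
qed

text \<open>Conjugation by a determinant 1 matrix \<open>A\<close> takes \<open>nilp v\<close> to
  \<open>nilp (A *v v)\<close>, and \<open>nilp\<close> is quadratic in its argument; this produces
  the factor \<open>l\<^sup>2\<close>.\<close>

lemma conjugate_unipotent:
  assumes "det A = 1" "A *v v = l *\<^sub>R v"
  shows "A ** (mat 1 + s *\<^sub>R nilp v) ** adjugate A = mat 1 + (l\<^sup>2 * s) *\<^sub>R nilp v"
proof -
  have e: "A$1$1 * v$1 + A$1$2 * v$2 = l * v$1" "A$2$1 * v$1 + A$2$2 * v$2 = l * v$2"
    using arg_cong[OF assms(2), of "\<lambda>u. u$1"] arg_cong[OF assms(2), of "\<lambda>u. u$2"]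
    by (simp_all add: matrix_vector_mult_2)
  have d: "A$1$1 * A$2$2 - A$1$2 * A$2$1 = 1" using assms(1) by (simp add: det_2)
  show ?thesis
    unfolding matrix_eq_2 matrix_mult_2 adjugate_nth vector_add_component vector_scaleR_component
      nilp_nth mat_1_2 real_scaleR_def
    using e d by (intro conjI; algebra)
qed

lemma unipotents_commute:
  "(mat 1 + s *\<^sub>R nilp v) ** (mat 1 + t *\<^sub>R nilp v) = (mat 1 + t *\<^sub>R nilp v) ** (mat 1 + s *\<^sub>R nilp v)"
  by (simp add: matrix_eq_2 matrix_mult_2 algebra_simps)


context first_kind_matrix_group
begin

text \<open>Commutators of elements with the common eigenvector \<open>v\<close> are unipotent, and conjugating a
  nontrivial one by powers of an element with eigenvalue of modulus below 1 gives infinitely many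
  elements in a bounded set. Hence such a group is commutative.\<close>

lemma no_common_eigenvector:
  assumes v: "v \<noteq> 0"
  shows "\<exists>A\<in>G. v$1 * (A *v v)$2 \<noteq> v$2 * (A *v v)$1"
proof (rule ccontr)
  assume "\<not> ?thesis"
  then have e: "v$1 * (A *v v)$2 = v$2 * (A *v v)$1" if "A \<in> G" for A using that by blast
  have "\<exists>l. A *v v = l *\<^sub>R v" if "A \<in> G" for A
  proof (cases "v$1 = 0")
    case True
    then have "v$2 \<noteq> 0" using vec2_nonzero[OF v] by simp
    then show ?thesis using e[OF that] True
      by (intro exI[of _ "(A *v v)$2 / v$2"]) (simp add: vec_eq_iff forall_2)
  next
    case False
    then show ?thesis using e[OF that]
      by (intro exI[of _ "(A *v v)$1 / v$1"]) (simp add: vec_eq_iff forall_2 field_simps)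
  qed
  then obtain l where l: "\<And>A. A \<in> G \<Longrightarrow> A *v v = l A *\<^sub>R v" by metis
  have ladj: "l (adjugate A) * l A = 1" if "A \<in> G" for A
  proof -
    have "v = adjugate A *v (A *v v)"
      using adjugate_mult(2)[OF det[OF that]] by (simp add: matrix_vector_mul_assoc)
    also have "\<dots> = (l (adjugate A) * l A) *\<^sub>R v"
      by (simp add: l that adjugate_closed matrix_vector_mult_scaleR mult.commute)
    finally have "(l (adjugate A) * l A) *\<^sub>R v = 1 *\<^sub>R v" by simp
    then show ?thesis using v by (simp only: scaleR_cancel_right) auto
  qed
  have discrete: "t = 0" if t: "mat 1 + t *\<^sub>R nilp v \<in> G" and A: "A \<in> G" "\<bar>l A\<bar> < 1" for t A
  proof (rule ccontr)
    assume "t \<noteq> 0"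
    define q where "q = (l A)\<^sup>2"
    have q: "0 < q" "q < 1"
      using ladj[OF A(1)] A(2) by (auto simp: q_def abs_square_less_1)
    define T where "T n = mat 1 + (q ^ n * t) *\<^sub>R nilp v" for n
    have TG: "T n \<in> G" for n
    proof (induction n)
      case (Suc n)
      have "T (Suc n) = A ** T n ** adjugate A"
        using conjugate_unipotent[OF det[OF A(1)] l[OF A(1)], of "q ^ n * t"]
        by (simp add: T_def q_def mult.assoc)
      with Suc A show ?case by (auto intro: mult_closed adjugate_closed)
    qed (use t in \<open>simp add: T_def\<close>)
    obtain i j where ij: "nilp v$i$j \<noteq> 0"
      using vec2_nonzero[OF v] nilp_nth(2,3)[of v] by (metis mult_eq_0_iff neg_equal_0_iff_equal mult_minus_left)
    have "inj T"
    proof (rule injI)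
      fix m n assume "T m = T n"
      then have "q ^ m * t * nilp v$i$j = q ^ n * t * nilp v$i$j"
        using arg_cong[of "T m" "T n" "\<lambda>M. M$i$j"] by (simp add: T_def)
      then have "q ^ m = q ^ n" using ij \<open>t \<noteq> 0\<close> by simp
      then show "m = n" using q by (metis power_inject_exp' less_irrefl power_strict_decreasing linorder_neqE_nat)
    qed
    then have "infinite (range T)" by (simp add: range_inj_infinite)
    moreover define R where "R = norm (mat 1 :: real^2^2) + \<bar>t\<bar> * norm (nilp v)"
    have "\<bar>T n$i$j\<bar> \<le> R" for n i j
    proof -
      have "\<bar>T n$i$j\<bar> \<le> norm (T n)"
        by (rule abs_matrix_nth_le_norm)
      also have "\<dots> \<le> norm (mat 1 :: real^2^2) + q ^ n * \<bar>t\<bar> * norm (nilp v)"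
        unfolding T_def using q by (intro order_trans[OF norm_triangle_ineq]) (simp add: abs_mult)
      also have "q ^ n * \<bar>t\<bar> * norm (nilp v) \<le> 1 * \<bar>t\<bar> * norm (nilp v)"
        using q by (intro mult_right_mono power_le_one) auto
      finally show ?thesis by (simp add: R_def)
    qed
    then have "range T \<subseteq> {A \<in> G. \<forall>i j. \<bar>A$i$j\<bar> \<le> R}" using TG by auto
    ultimately show False using finite_bounded finite_subset by blast
  qed
  \<comment> \<open>The factors \<open>l\<close> cancel in a commutator, which therefore fixes
    \<open>v\<close> and is unipotent; \<open>discrete\<close> makes it trivial. If \<open>D\<close>
    has an eigenvalue of modulus above 1, its inverse serves in its place.\<close>
  have comm: "A ** B = B ** A" if A: "A \<in> G" and B: "B \<in> G" and D: "D \<in> G" "\<bar>l D\<bar> \<noteq> 1" for A B D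
  proof -
    obtain D' where D': "D' \<in> G" "\<bar>l D'\<bar> < 1"
    proof (cases "\<bar>l D\<bar> < 1")
      case False
      with D have "\<bar>l D\<bar> > 1" by simp
      moreover have "\<bar>l (adjugate D)\<bar> * \<bar>l D\<bar> = 1" using ladj[OF D(1)] by (metis abs_mult abs_one)
      ultimately have "\<bar>l (adjugate D)\<bar> < 1"
        by (metis abs_ge_zero linorder_not_less mult_le_cancel_right1 order_less_le_trans zero_less_one less_irrefl)
      with D show ?thesis using that adjugate_closed by blast
    qed (use D that in blast)
    define C where "C = A ** B ** adjugate A ** adjugate B"
    have CG: "C \<in> G" using A B by (simp add: C_def mult_closed adjugate_closed)
    have "C *v v = (l A * l B * l (adjugate A) * l (adjugate B)) *\<^sub>R v"
      unfolding C_def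
      by (simp add: matrix_vector_mul_assoc[symmetric] matrix_vector_mult_scaleR l A B adjugate_closed mult_ac)
    also have "l A * l B * l (adjugate A) * l (adjugate B) = 1"
      using ladj[OF A] ladj[OF B] by algebra
    finally have "C *v v = v" by simp
    then obtain t where t: "C = mat 1 + t *\<^sub>R nilp v"
      using fixing_vector_unipotent[OF det[OF CG] _ v] by blast
    with discrete[OF _ D'] CG have "C = mat 1" by simp
    then have "B ** A = C ** (B ** A)" by simp
    also have "\<dots> = A ** B ** (adjugate A ** (adjugate B ** B) ** A)"
      by (simp add: C_def matrix_mul_assoc)
    also have "\<dots> = A ** B" by (simp add: adjugate_mult det A B)
    finally show ?thesis by simp
  qed
  obtain A B where AB: "A \<in> G" "B \<in> G" "A ** B \<noteq> B ** A" using noncommutative by blast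
  \<comment> \<open>Since \<open>A\<close> and \<open>B\<close> do not commute, \<open>comm\<close>
    leaves only eigenvalues 1 and -1 on \<open>v\<close>. Up to sign every element then lies in the
    commutative family of unipotents fixing \<open>v\<close>.\<close>
  have "\<exists>t e. e *\<^sub>R D = mat 1 + t *\<^sub>R nilp v \<and> e \<in> {1, -1}" if D: "D \<in> G" for D
  proof -
    have "\<bar>l D\<bar> = 1" using comm[OF AB(1,2) D] AB(3) by blast
    then have lD: "l D \<in> {1, -1}" by auto
    have "(l D *\<^sub>R D) *v v = l D *\<^sub>R (D *v v)"
      by (simp add: vec_eq_iff forall_2 matrix_vector_mult_2 algebra_simps)
    also have "\<dots> = v" using lD by (auto simp: l[OF D])
    finally have "(l D *\<^sub>R D) *v v = v" .
    moreover have "det (l D *\<^sub>R D) = 1" using lD det[OF D] by (auto simp: det_2)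
    ultimately show ?thesis using fixing_vector_unipotent[OF _ _ v, of "l D *\<^sub>R D"] lD by blast
  qed
  then obtain s t e d where
    "e *\<^sub>R A = mat 1 + s *\<^sub>R nilp v" "d *\<^sub>R B = mat 1 + t *\<^sub>R nilp v" and ed: "e \<in> {1, -1}" "d \<in> {1, -1::real}"
    using AB(1,2) by meson
  then have "(e *\<^sub>R A) ** (d *\<^sub>R B) = (d *\<^sub>R B) ** (e *\<^sub>R A)" using unipotents_commute by simp
  then have "(e * d) *\<^sub>R (A ** B) = (e * d) *\<^sub>R (B ** A)"
    by (simp add: matrix_eq_2 matrix_mult_2 algebra_simps)
  then show False using ed AB(3) by auto
qed

end

section \<open>Orbits of boundary points\<close>

text \<open>The coefficients \<open>\<alpha>\<close>, \<open>\<beta>\<close> express the vector with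
  entries \<open>\<i>\<close> and 1 in the basis \<open>v\<close>, \<open>w\<close>. Then
  \<open>den A \<i>\<close> is the same combination of the second coordinates of
  \<open>A *v v\<close> and \<open>A *v w\<close>, so one of these is not small compared with it,
  and that vector gives the close boundary point.\<close>

lemma real_vector_close:
  fixes v w :: "real^2"
  assumes D: "v$1 * w$2 \<noteq> v$2 * w$1"
  obtains K where "K \<ge> 0" and "\<And>A. det A = 1 \<Longrightarrow> \<exists>u\<in>{v, w}. (A *v u)$2 \<noteq> 0 \<and>
    cmod (of_real ((A *v u)$1 / (A *v u)$2) - act A \<i>) \<le> K * Im (act A \<i>)"
proof -
  define N where "N u = cmod (of_real (u$1) - \<i> * of_real (u$2))" for u :: "real^2"
  define d where "d = complex_of_real (v$1 * w$2 - v$2 * w$1)"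
  define \<alpha> where "\<alpha> = (\<i> * of_real (w$2) - of_real (w$1)) / d"
  define \<beta> where "\<beta> = (of_real (v$1) - \<i> * of_real (v$2)) / d"
  define M where "M = cmod \<alpha> + cmod \<beta>"
  have d: "d \<noteq> 0" unfolding d_def of_real_eq_0_iff using D by simp
  have ab: "\<alpha> * of_real (v$1) + \<beta> * of_real (w$1) = \<i>" "\<alpha> * of_real (v$2) + \<beta> * of_real (w$2) = 1"
    using d by (simp_all add: \<alpha>_def \<beta>_def field_simps) (simp_all add: d_def algebra_simps)
  have M: "M \<ge> 0" by (simp add: M_def)
  show ?thesis
  proof (rule that[of "(N v + N w) * M"])
    show "(N v + N w) * M \<ge> 0" using M by (simp add: N_def)
  next
    fix A :: "real^2^2" assume A: "det A = 1"
    have nz: "den A \<i> \<noteq> 0" by (rule den_nonzero[OF A]) simp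
    have "den A \<i> = \<alpha> * of_real ((A *v v)$2) + \<beta> * of_real ((A *v w)$2)"
    proof -
      have "\<alpha> * of_real ((A *v v)$2) + \<beta> * of_real ((A *v w)$2) =
        of_real (A$2$1) * (\<alpha> * of_real (v$1) + \<beta> * of_real (w$1)) +
        of_real (A$2$2) * (\<alpha> * of_real (v$2) + \<beta> * of_real (w$2))"
        by (simp add: matrix_vector_mult_2 algebra_simps)
      then show ?thesis by (simp add: ab den_def)
    qed
    then have le: "cmod (den A \<i>) \<le> cmod \<alpha> * \<bar>(A *v v)$2\<bar> + cmod \<beta> * \<bar>(A *v w)$2\<bar>"
      using norm_triangle_ineq by (metis norm_mult norm_of_real)
    obtain u where u: "u \<in> {v, w}" "cmod (den A \<i>) \<le> M * \<bar>(A *v u)$2\<bar>"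
    proof (cases "\<bar>(A *v v)$2\<bar> \<le> \<bar>(A *v w)$2\<bar>")
      case True
      then have "cmod \<alpha> * \<bar>(A *v v)$2\<bar> \<le> cmod \<alpha> * \<bar>(A *v w)$2\<bar>" by (intro mult_left_mono) auto
      with le show ?thesis using that[of w] by (simp add: M_def algebra_simps)
    next
      case False
      then have "cmod \<beta> * \<bar>(A *v w)$2\<bar> \<le> cmod \<beta> * \<bar>(A *v v)$2\<bar>" by (intro mult_left_mono) auto
      with le show ?thesis using that[of v] by (simp add: M_def algebra_simps)
    qed
    define p where "p = (A *v u)$2"
    have p: "p \<noteq> 0" using u(2) nz by (auto simp: p_def)
    have dt: "of_real (A$1$1) * of_real (A$2$2) - of_real (A$1$2) * of_real (A$2$1) = (1::complex)"
      using arg_cong[OF A, of complex_of_real] by (simp add: det_2)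
    \<comment> \<open>On the left stands the determinant formed by the images under \<open>A\<close>
      of \<open>u\<close> and of the vector with entries \<open>\<i>\<close> and 1; a matrix of
      determinant 1 preserves it.\<close>
    have num: "of_real ((A *v u)$1) * den A \<i> - of_real p * (of_real (A$1$1) * \<i> + of_real (A$1$2))
        = of_real (u$1) - \<i> * of_real (u$2)"
      unfolding den_def p_def matrix_vector_mult_2 of_real_add of_real_mult using dt by algebra
    have "of_real ((A *v u)$1 / p) - act A \<i> = (of_real (u$1) - \<i> * of_real (u$2)) / (of_real p * den A \<i>)"
      unfolding num[symmetric] act_def using p nz by (simp add: field_simps)
    then have "cmod (of_real ((A *v u)$1 / p) - act A \<i>) = N u / (\<bar>p\<bar> * cmod (den A \<i>))"
      by (simp add: N_def norm_divide norm_mult)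
    also have "\<dots> = N u * cmod (den A \<i>) / (\<bar>p\<bar> * (cmod (den A \<i>))\<^sup>2)"
      using nz by (simp add: power2_eq_square)
    also have "\<dots> \<le> N u * (M * \<bar>p\<bar>) / (\<bar>p\<bar> * (cmod (den A \<i>))\<^sup>2)"
      using u(2) unfolding p_def by (intro divide_right_mono mult_left_mono) (auto simp: N_def)
    also have "\<dots> = N u * M * Im (act A \<i>)" using p A by (simp add: Im_act)
    also have "\<dots> \<le> (N v + N w) * M * Im (act A \<i>)"
      using u(1) M Im_act_pos[OF A, of \<i>] by (intro mult_right_mono) (auto simp: N_def)
    finally show "\<exists>u\<in>{v, w}. (A *v u)$2 \<noteq> 0 \<and>
        cmod (of_real ((A *v u)$1 / (A *v u)$2) - act A \<i>) \<le> (N v + N w) * M * Im (act A \<i>)"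
      using u(1) p unfolding p_def by blast
  qed
qed

context first_kind_matrix_group
begin

text \<open>\<open>no_common_eigenvector\<close> supplies a second boundary point
  \<open>B *v v\<close> of the same orbit. Whichever of the two is carried towards \<open>x\<close>,
  the result is an image of \<open>v\<close>.\<close>

lemma real_orbit_dense:
  assumes v: "v \<noteq> 0" and e: "e > 0"
  shows "\<exists>A\<in>G. (A *v v)$2 \<noteq> 0 \<and> \<bar>(A *v v)$1 / (A *v v)$2 - x\<bar> < e"
proof -
  obtain B where B: "B \<in> G" "v$1 * (B *v v)$2 \<noteq> v$2 * (B *v v)$1"
    using no_common_eigenvector[OF v] by blast
  obtain K where K: "K \<ge> 0" "\<And>A. det A = 1 \<Longrightarrow> \<exists>u\<in>{v, B *v v}. (A *v u)$2 \<noteq> 0 \<and>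
      cmod (of_real ((A *v u)$1 / (A *v u)$2) - act A \<i>) \<le> K * Im (act A \<i>)"
    using real_vector_close[OF B(2)] by metis
  obtain A where A: "\<And>n. A n \<in> G" "\<And>w. Im w \<noteq> 0 \<Longrightarrow> (\<lambda>n. act (A n) w) \<longlonglongrightarrow> of_real x"
    using exhausting_sequence by blast
  have "(\<lambda>n. act (A n) \<i>) \<longlonglongrightarrow> of_real x" using A(2) by simp
  from LIMSEQ_D[OF this, of "e / (K + 1)"] obtain n where n: "cmod (act (A n) \<i> - of_real x) < e / (K + 1)"
    using e K(1) by (meson divide_pos_pos add_nonneg_pos zero_less_one order_refl)
  obtain u where u: "u \<in> {v, B *v v}" "(A n *v u)$2 \<noteq> 0"
      "cmod (of_real ((A n *v u)$1 / (A n *v u)$2) - act (A n) \<i>) \<le> K * Im (act (A n) \<i>)"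
    using K(2)[OF det[OF A(1)]] by blast
  have "\<bar>(A n *v u)$1 / (A n *v u)$2 - x\<bar> = cmod (of_real ((A n *v u)$1 / (A n *v u)$2) - of_real x)"
    by (metis norm_of_real of_real_diff)
  also have "\<dots> \<le> cmod (of_real ((A n *v u)$1 / (A n *v u)$2) - act (A n) \<i>) + cmod (act (A n) \<i> - of_real x)"
    using norm_triangle_ineq by (metis diff_add_cancel add_diff_eq)
  also have "\<dots> \<le> K * cmod (act (A n) \<i> - of_real x) + cmod (act (A n) \<i> - of_real x)"
    using u(3) abs_Im_le_cmod[of "act (A n) \<i> - of_real x"] K(1)
    by (smt (verit) Im_complex_of_real minus_complex.sel(2) mult_left_mono)
  also have "\<dots> < e" using n K(1) by (simp add: field_simps)
  finally have *: "\<bar>(A n *v u)$1 / (A n *v u)$2 - x\<bar> < e" .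
  show ?thesis
  proof (cases "u = v")
    case True
    then show ?thesis using A(1) u(2) * by blast
  next
    case False
    then have "u = B *v v" using u(1) by simp
    then show ?thesis using mult_closed[OF A(1) B(1)] u(2) *
      by (intro bexI[of _ "A n ** B"]) (simp_all add: matrix_vector_mul_assoc)
  qed
qed

lemma infinite_orbit_near_real:
  fixes x :: real
  assumes v: "v \<noteq> 0" and e: "e > 0"
  shows "infinite ({of_real ((A *v v)$1 / (A *v v)$2) | A. A \<in> G \<and> (A *v v)$2 \<noteq> 0} \<inter> ball (complex_of_real x) e)"
    (is "infinite (?O \<inter> _)")
proof -
  have "complex_of_real x islimpt ?O"
    unfolding islimpt_approachable
  proof (intro allI impI)
    fix r :: real assume r: "r > 0"
    \<comment> \<open>Aiming at \<open>x + r / 2\<close> with tolerance \<open>r / 2\<close> keeps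
      the orbit point within \<open>r\<close> of \<open>x\<close> and yet distinct from
      \<open>x\<close>.\<close>
    obtain A where A: "A \<in> G" "(A *v v)$2 \<noteq> 0" "\<bar>(A *v v)$1 / (A *v v)$2 - (x + r / 2)\<bar> < r / 2"
      using real_orbit_dense[OF v, of "r / 2" "x + r / 2"] r by auto
    define y where "y = (A *v v)$1 / (A *v v)$2"
    have "y \<noteq> x" "\<bar>y - x\<bar> < r" using A(3) unfolding y_def[symmetric] by linarith+
    then have "complex_of_real y \<noteq> of_real x" "dist (complex_of_real y) (of_real x) < r"
      by (simp_all add: dist_norm flip: of_real_diff)
    then show "\<exists>x'\<in>?O. x' \<noteq> of_real x \<and> dist x' (of_real x) < r"
      using A(1,2) unfolding y_def by blast
  qed
  then show ?thesis using e unfolding islimpt_eq_infinite_ball by blast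
qed

text \<open>A point of the sphere is either nonreal or given by a real vector of homogeneous
  coordinates: \<open>[1, 0]\<close> for infinity, \<open>[Re z, 1]\<close> for a real
  \<open>z\<close>.\<close>

lemma infinite_orbit_near:
  assumes e: "e > 0"
  shows "infinite ({y. \<exists>A\<in>G. mobius A w = Some y} \<inter> ball (of_real x) e)"
proof (cases "\<exists>z. w = Some z \<and> Im z \<noteq> 0")
  case True
  then obtain z where z: "w = Some z" "Im z \<noteq> 0" by blast
  have "mobius A w = Some (act A z)" if "A \<in> G" for A
    using den_nonzero[OF det[OF that] z(2)] z(1)
    by (simp add: mobius_def act_def den_def moebius_def)
  then have "(\<lambda>A. act A z) ` G \<subseteq> {y. \<exists>A\<in>G. mobius A w = Some y}" by auto
  then show ?thesis
    using infinite_orbit_near_nonreal[OF z(2) e, of x] by (meson Int_mono finite_subset order_refl)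
next
  case False
  obtain v :: "real^2" where v: "v \<noteq> 0"
    "\<And>A. (A *v v)$2 \<noteq> 0 \<Longrightarrow> mobius A w = Some (of_real ((A *v v)$1 / (A *v v)$2))"
  proof (cases w)
    case None
    show ?thesis
    proof (rule that)
      show "(vector [1, 0] :: real^2) \<noteq> 0" by (simp add: vec_eq_iff forall_2)
    qed (simp add: None mobius_def matrix_vector_mult_2)
  next
    case (Some z)
    then have z: "z = of_real (Re z)" using False by (simp add: complex_eq_iff)
    show ?thesis
    proof (rule that)
      show "(vector [Re z, 1] :: real^2) \<noteq> 0" by (simp add: vec_eq_iff forall_2)
    next
      fix A :: "real^2^2" assume "(A *v (vector [Re z, 1] :: real^2))$2 \<noteq> 0"
      then have "complex_of_real (A$2$1 * Re z + A$2$2) \<noteq> 0"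
        by (simp add: matrix_vector_mult_2 del: of_real_add of_real_mult)
      then have "complex_of_real (A$2$1) * of_real (Re z) + of_real (A$2$2) \<noteq> 0" by simp
      then show "mobius A w = Some (of_real ((A *v (vector [Re z, 1] :: real^2))$1 /
          (A *v (vector [Re z, 1] :: real^2))$2))"
        unfolding Some by (subst z) (simp add: mobius_def moebius_def matrix_vector_mult_2)
    qed
  qed
  have "{of_real ((A *v v)$1 / (A *v v)$2) | A. A \<in> G \<and> (A *v v)$2 \<noteq> 0} \<subseteq> {y. \<exists>A\<in>G. mobius A w = Some y}"
    using v(2) by auto
  then show ?thesis
    using infinite_orbit_near_real[OF v(1) e, of x] by (meson Int_mono finite_subset order_refl)
qed

end

section \<open>Equivariant self-maps of the half-plane\<close>

text \<open>This is \<open>2 * (cosh d - 1)\<close> for the hyperbolic distance \<open>d\<close>.\<close>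

definition hyp_gap :: "complex \<Rightarrow> complex \<Rightarrow> real" where
  "hyp_gap z w = (cmod (z - w))\<^sup>2 / (Im z * Im w)"

text \<open>With \<open>g = hyp_gap z w\<close>, the square of
  \<open>cmod (z - w) / cmod (z - cnj w)\<close> is \<open>g / (g + 4)\<close>, an increasing
  function of \<open>g\<close>.\<close>

lemma hyp_gap_le_iff:
  assumes "Im z > 0" "Im w > 0" "Im a > 0" "Im b > 0"
  shows "hyp_gap a b \<le> hyp_gap z w \<longleftrightarrow>
    cmod (a - b) * cmod (z - cnj w) \<le> cmod (z - w) * cmod (a - cnj b)"
proof -
  have "hyp_gap a b \<le> hyp_gap z w \<longleftrightarrow>
      (cmod (a - b))\<^sup>2 * (Im z * Im w) \<le> (cmod (z - w))\<^sup>2 * (Im a * Im b)"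
    using assms by (simp add: hyp_gap_def divide_simps)
  also have "\<dots> \<longleftrightarrow> (cmod (a - b))\<^sup>2 * (cmod (z - cnj w))\<^sup>2 \<le> (cmod (z - w))\<^sup>2 * (cmod (a - cnj b))\<^sup>2"
    unfolding cmod_diff_cnj_squared by (simp add: algebra_simps)
  also have "\<dots> \<longleftrightarrow> cmod (a - b) * cmod (z - cnj w) \<le> cmod (z - w) * cmod (a - cnj b)"
    unfolding power_mult_distrib[symmetric] by (intro power_mono_iff) auto
  finally show ?thesis .
qed

lemma Schwarz_Pick_hyp_gap:
  assumes holo: "f holomorphic_on {z. Im z > 0}"
    and maps: "\<And>z. Im z > 0 \<Longrightarrow> Im (f z) > 0"
    and w: "Im w > 0" and z: "Im z > 0"
  shows "hyp_gap (f z) (f w) \<le> hyp_gap z w"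
    and "z \<noteq> w \<Longrightarrow> hyp_gap (f z) (f w) = hyp_gap z w \<Longrightarrow>
         \<exists>\<alpha>. \<forall>\<zeta>. Im \<zeta> > 0 \<longrightarrow> (f \<zeta> - f w) * (\<zeta> - cnj w) = \<alpha> * (\<zeta> - w) * (f \<zeta> - cnj (f w))"
proof -
  show le: "hyp_gap (f z) (f w) \<le> hyp_gap z w"
    using upper_half_plane_Schwarz_Pick(1)[OF assms] by (simp add: hyp_gap_le_iff maps w z)
  assume ne: "z \<noteq> w" and "hyp_gap (f z) (f w) = hyp_gap z w"
  then have "hyp_gap z w \<le> hyp_gap (f z) (f w)" by simp
  then have "cmod (z - w) * cmod (f z - cnj (f w)) \<le> cmod (f z - f w) * cmod (z - cnj w)"
    by (simp add: hyp_gap_le_iff maps w z)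
  with upper_half_plane_Schwarz_Pick(1)[OF assms] show
    "\<exists>\<alpha>. \<forall>\<zeta>. Im \<zeta> > 0 \<longrightarrow> (f \<zeta> - f w) * (\<zeta> - cnj w) = \<alpha> * (\<zeta> - w) * (f \<zeta> - cnj (f w))"
    by (intro upper_half_plane_Schwarz_Pick(2)[OF holo maps w z ne] antisym) auto
qed

lemma hyp_gap_act_self:
  assumes "det A = 1" "Im z > 0"
  shows "hyp_gap (act A z) z = (cmod (fixform A z) / Im z)\<^sup>2"
proof -
  have nz: "den A z \<noteq> 0" using assms by (intro den_nonzero) auto
  show ?thesis
    using nz assms unfolding hyp_gap_def act_minus_self[OF nz]
    by (simp add: Im_act norm_divide power_divide power2_eq_square)
qed

context first_kind_matrix_group
begin

text \<open>Along a sequence of group elements carrying \<open>\<i>\<close> to a real \<open>x\<close>, \<open>h\<close> tends to \<open>x\<close> as well, so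
  the identity holds with \<open>\<zeta> = h \<zeta> = x\<close>. Being polynomial in \<open>x\<close>, it then holds at \<open>x = w\<close>.\<close>

lemma equivariant_cayley_form_fixes:
  assumes equiv: "\<And>A z. A \<in> G \<Longrightarrow> Im z > 0 \<Longrightarrow> h (act A z) = act A (h z)"
    and nonreal: "\<And>z. Im z > 0 \<Longrightarrow> Im (h z) \<noteq> 0"
    and w: "Im w > 0"
    and form: "\<And>\<zeta>. Im \<zeta> > 0 \<Longrightarrow> (h \<zeta> - h w) * (\<zeta> - cnj w) = \<alpha> * (\<zeta> - w) * (h \<zeta> - cnj (h w))"
  shows "h w = w"
proof -
  define p where "p = h w"
  have lim: "(of_real x - p) * (of_real x - cnj w) = \<alpha> * (of_real x - w) * (of_real x - cnj p)" for x :: real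
  proof -
    obtain A where A: "\<And>n. A n \<in> G" "\<And>w. Im w \<noteq> 0 \<Longrightarrow> (\<lambda>n. act (A n) w) \<longlonglongrightarrow> of_real x"
      using exhausting_sequence by blast
    have l: "(\<lambda>n. act (A n) \<i>) \<longlonglongrightarrow> of_real x" "(\<lambda>n. act (A n) (h \<i>)) \<longlonglongrightarrow> of_real x"
      using A(2) nonreal[of \<i>] by simp_all
    have eq: "(act (A n) (h \<i>) - p) * (act (A n) \<i> - cnj w) = \<alpha> * (act (A n) \<i> - w) * (act (A n) (h \<i>) - cnj p)" for n
      using form[of "act (A n) \<i>"] equiv[OF A(1), of \<i>] Im_act_pos[OF det[OF A(1)], of \<i>]
      by (simp add: p_def)
    have "(\<lambda>n. (act (A n) (h \<i>) - p) * (act (A n) \<i> - cnj w)) \<longlonglongrightarrow> (of_real x - p) * (of_real x - cnj w)"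
      by (intro tendsto_intros l)
    moreover have "(\<lambda>n. (act (A n) (h \<i>) - p) * (act (A n) \<i> - cnj w)) \<longlonglongrightarrow> \<alpha> * (of_real x - w) * (of_real x - cnj p)"
      unfolding eq by (intro tendsto_intros l)
    ultimately show ?thesis using LIMSEQ_unique by blast
  qed
  have e0: "p * cnj w = \<alpha> * w * cnj p" using lim[of 0] by simp
  have e1: "1 - p - cnj w + p * cnj w = \<alpha> * (1 - w - cnj p + w * cnj p)"
    using lim[of 1] by (simp add: algebra_simps)
  have e2: "1 + p + cnj w + p * cnj w = \<alpha> * (1 + w + cnj p + w * cnj p)"
    using lim[of "-1"] by (simp add: algebra_simps)
  \<comment> \<open>The second difference of the values at -1, 0 and 1 compares the leading
    coefficients of the two quadratic polynomials.\<close>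
  have "2 * (1 - \<alpha>) = 0" using e0 e1 e2 by algebra
  then have \<alpha>: "\<alpha> = 1" by simp
  have "2 * ((w - p) * (w - cnj w)) = 0" using e0 e1 e2 unfolding \<alpha> by algebra
  moreover have "w - cnj w \<noteq> 0" using w by (auto simp: complex_eq_iff)
  ultimately show ?thesis by (simp add: p_def)
qed

text \<open>The group carries a fixed point to further fixed points. Two of them give equality in
  the Schwarz-Pick lemma, and evaluating the resulting identity at the second one shows that
  \<open>\<alpha>\<close> is 1.\<close>

lemma equivariant_self_map_with_fixed_point:
  assumes holo: "f holomorphic_on {z. Im z > 0}"
    and maps: "\<And>z. Im z > 0 \<Longrightarrow> Im (f z) > 0"
    and equiv: "\<And>A z. A \<in> G \<Longrightarrow> Im z > 0 \<Longrightarrow> f (act A z) = act A (f z)"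
    and p: "Im p > 0" "f p = p"
    and z: "Im z > 0"
  shows "f z = z"
proof -
  have "infinite ((\<lambda>A. act A p) ` G)"
    using infinite_orbit_near_nonreal[of p 1 0] p(1) by auto
  then obtain A where A: "A \<in> G" "act A p \<noteq> p"
    by (metis (mono_tags, lifting) finite.simps finite_subset image_subsetI insertI1)
  define q where "q = act A p"
  have q: "Im q > 0" "q \<noteq> p" "f q = q"
    using A p equiv[OF A(1) p(1)] Im_act_pos[OF det[OF A(1)] p(1)] by (auto simp: q_def)
  obtain \<alpha> where \<alpha>: "\<And>\<zeta>. Im \<zeta> > 0 \<Longrightarrow> (f \<zeta> - p) * (\<zeta> - cnj p) = \<alpha> * (\<zeta> - p) * (f \<zeta> - cnj p)"
    using Schwarz_Pick_hyp_gap(2)[OF holo maps p(1) q(1) q(2)] q(3) p(2) by auto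
  have "q - cnj p \<noteq> 0" using q p by auto
  with \<alpha>[OF q(1)] q have "\<alpha> = 1" by simp
  with \<alpha>[OF z] have "(f z - z) * (p - cnj p) = 0" by algebra
  moreover have "p - cnj p \<noteq> 0" using p by (auto simp: complex_eq_iff)
  ultimately show ?thesis by simp
qed

text \<open>If the orbit of \<open>\<i>\<close> under \<open>f\<close> left every compact subset of the half-plane, each element of
  \<open>G\<close>, which moves all points of the orbit by a bounded hyperbolic distance, would fix its boundary
  limit. On the closure of the orbit the displacement of \<open>f\<close> therefore attains a minimum.\<close>

lemma equivariant_self_map_eq_id:
  assumes holo: "f holomorphic_on {z. Im z > 0}"
    and maps: "\<And>z. Im z > 0 \<Longrightarrow> Im (f z) > 0"
    and equiv: "\<And>A z. A \<in> G \<Longrightarrow> Im z > 0 \<Longrightarrow> f (act A z) = act A (f z)"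
    and z: "Im z > 0"
  shows "f z = z"
proof -
  define \<zeta> where "\<zeta> n = (f ^^ n) \<i>" for n
  have \<zeta>_pos: "Im (\<zeta> n) > 0" for n by (induction n) (auto simp: \<zeta>_def maps)
  \<comment> \<open>Since \<open>f\<close> commutes with \<open>A\<close> and does not increase
    gaps, the displacement by \<open>A\<close> at any point of the orbit is at most the one at
    \<open>\<i>\<close>.\<close>
  have displacement: "\<exists>C\<ge>0. \<forall>n. cmod (fixform A (\<zeta> n)) \<le> C * Im (\<zeta> n)" if A: "A \<in> G" for A
  proof -
    have it: "(f ^^ n) (act A \<i>) = act A (\<zeta> n)" for n
      using \<zeta>_pos by (induction n) (auto simp: \<zeta>_def equiv[OF A])
    have gap: "hyp_gap (act A (\<zeta> n)) (\<zeta> n) \<le> hyp_gap (act A \<i>) \<i>" for n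
    proof (induction n)
      case (Suc n)
      have "hyp_gap (f (act A (\<zeta> n))) (f (\<zeta> n)) \<le> hyp_gap (act A (\<zeta> n)) (\<zeta> n)"
        by (intro Schwarz_Pick_hyp_gap(1)[OF holo maps] \<zeta>_pos Im_act_pos det A)
      with Suc show ?case using it[of "Suc n"] it[of n] by (simp add: \<zeta>_def)
    qed (simp add: \<zeta>_def)
    have le: "(cmod (fixform A (\<zeta> n)) / Im (\<zeta> n))\<^sup>2 \<le> (cmod (fixform A \<i>))\<^sup>2" for n
      using gap[of n] hyp_gap_act_self[OF det[OF A] \<zeta>_pos, of n] hyp_gap_act_self[OF det[OF A], of \<i>]
      by simp
    have "cmod (fixform A (\<zeta> n)) / Im (\<zeta> n) \<le> cmod (fixform A \<i>)" for n
      by (rule power2_le_imp_le[OF le]) simp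
    then show ?thesis using \<zeta>_pos
      by (intro exI[of _ "cmod (fixform A \<i>)"]) (simp add: field_simps)
  qed
  have bdd: "bounded (range \<zeta>)"
  proof (rule ccontr)
    assume nb: "\<not> bounded (range \<zeta>)"
    \<comment> \<open>Far out on the orbit the quadratic term of \<open>fixform\<close> would
      dominate: for modulus at least 1, the other terms and the displacement bound amount to at most
      \<open>E * cmod (\<zeta> n)\<close>. Thus every \<open>A\<close> fixes infinity and has the
      eigenvector \<open>[1, 0]\<close>.\<close>
    have "A$2$1 = 0" if A: "A \<in> G" for A
    proof (rule ccontr)
      assume c: "A$2$1 \<noteq> 0"
      obtain C where C: "C \<ge> 0" "\<And>n. cmod (fixform A (\<zeta> n)) \<le> C * Im (\<zeta> n)"
        using displacement[OF A] by blast
      define E where "E = C + \<bar>A$2$2 - A$1$1\<bar> + \<bar>A$1$2\<bar>"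
      obtain n where n: "cmod (\<zeta> n) > 1 + E / \<bar>A$2$1\<bar>"
        using nb unfolding bounded_iff by (auto simp: not_le)
      have E: "E \<ge> 0" using C by (simp add: E_def)
      have n1: "cmod (\<zeta> n) \<ge> 1" using n divide_nonneg_nonneg[OF E abs_ge_zero[of "A$2$1"]] by linarith
      have "of_real (A$2$1) * (\<zeta> n)\<^sup>2 = fixform A (\<zeta> n) - of_real (A$2$2 - A$1$1) * \<zeta> n + of_real (A$1$2)"
        by (simp add: fixform_def)
      then have "\<bar>A$2$1\<bar> * (cmod (\<zeta> n))\<^sup>2 =
          cmod (fixform A (\<zeta> n) - of_real (A$2$2 - A$1$1) * \<zeta> n + of_real (A$1$2))"
        by (metis norm_mult norm_of_real norm_power)
      also have "\<dots> \<le> cmod (fixform A (\<zeta> n)) + \<bar>A$2$2 - A$1$1\<bar> * cmod (\<zeta> n) + \<bar>A$1$2\<bar>"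
        by (intro order_trans[OF norm_triangle_ineq] add_mono order_trans[OF norm_triangle_ineq4])
           (simp_all add: norm_mult flip: of_real_diff)
      also have "cmod (fixform A (\<zeta> n)) \<le> C * cmod (\<zeta> n)"
        using C(2)[of n] C(1) abs_Im_le_cmod[of "\<zeta> n"]
        by (meson abs_ge_self mult_left_mono order_trans)
      also have "\<bar>A$1$2\<bar> \<le> \<bar>A$1$2\<bar> * cmod (\<zeta> n)" using n1 by (simp add: mult_le_cancel_left1)
      finally have "\<bar>A$2$1\<bar> * (cmod (\<zeta> n))\<^sup>2 \<le> E * cmod (\<zeta> n)"
        by (simp add: E_def algebra_simps)
      moreover have "\<zeta> n \<noteq> 0" using n1 by auto
      ultimately have "\<bar>A$2$1\<bar> * cmod (\<zeta> n) \<le> E"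
        using mult_right_le_imp_le[of "\<bar>A$2$1\<bar> * cmod (\<zeta> n)" "cmod (\<zeta> n)" E]
        by (simp add: power2_eq_square mult.assoc)
      moreover have "\<bar>A$2$1\<bar> * cmod (\<zeta> n) > \<bar>A$2$1\<bar> * (E / \<bar>A$2$1\<bar>)"
        using n c by (intro mult_strict_left_mono) auto
      ultimately show False using c by simp
    qed
    moreover have "(vector [1, 0] :: real^2) \<noteq> 0" by (simp add: vec_eq_iff forall_2)
    ultimately show False
      using no_common_eigenvector[of "vector [1, 0]"] by (simp add: matrix_vector_mult_2)
  qed
  \<comment> \<open>Otherwise a subsequence of the orbit tends to a real \<open>l\<close>. By
    \<open>displacement\<close> every \<open>fixform A\<close> vanishes at \<open>l\<close>, which
    makes \<open>[Re l, 1]\<close> a common eigenvector.\<close>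
  obtain \<epsilon> where \<epsilon>: "\<epsilon> > 0" "\<And>n. Im (\<zeta> n) \<ge> \<epsilon>"
  proof (rule ccontr)
    assume "\<not> thesis"
    then have "\<forall>k. \<exists>n. Im (\<zeta> n) < inverse (real (Suc k))"
      using that by (metis inverse_positive_iff_positive not_le of_nat_0_less_iff zero_less_Suc)
    then obtain m where m: "\<And>k. Im (\<zeta> (m k)) < inverse (real (Suc k))" by metis
    have "bounded (range (\<zeta> \<circ> m))" using bdd by (rule bounded_subset) auto
    then obtain l r where r: "strict_mono r" "((\<zeta> \<circ> m) \<circ> r) \<longlonglongrightarrow> l"
      using bounded_imp_convergent_subsequence by blast
    define u where "u = \<zeta> \<circ> m \<circ> r"
    have u: "u \<longlonglongrightarrow> l" using r by (simp add: u_def)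
    have "(\<lambda>k. Im ((\<zeta> \<circ> m) k)) \<longlonglongrightarrow> 0"
      by (rule tendsto_sandwich[OF _ _ tendsto_const LIMSEQ_inverse_real_of_nat])
         (auto intro!: always_eventually less_imp_le[OF m] less_imp_le[OF \<zeta>_pos] simp del: of_nat_Suc)
    from LIMSEQ_subseq_LIMSEQ[OF this r(1)] have u0: "(\<lambda>k. Im (u k)) \<longlonglongrightarrow> 0"
      by (simp add: u_def o_def)
    with tendsto_Im[OF u] have "Im l = 0" using LIMSEQ_unique by blast
    then have l: "l = of_real (Re l)" by (simp add: complex_eq_iff)
    have "fixform A l = 0" if A: "A \<in> G" for A
    proof -
      obtain C where C: "\<And>n. cmod (fixform A (\<zeta> n)) \<le> C * Im (\<zeta> n)" using displacement[OF A] by blast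
      have "(\<lambda>k. C * Im (u k)) \<longlonglongrightarrow> 0" using tendsto_mult_right_zero[OF u0] .
      then have "(\<lambda>k. fixform A (u k)) \<longlonglongrightarrow> 0"
        by (rule Lim_null_comparison[rotated]) (auto simp: u_def C)
      moreover have "(\<lambda>k. fixform A (u k)) \<longlonglongrightarrow> fixform A l"
        unfolding fixform_def by (intro tendsto_intros u)
      ultimately show ?thesis using LIMSEQ_unique by blast
    qed
    then have "Re (fixform A (of_real (Re l))) = 0" if "A \<in> G" for A
      using l that by (metis zero_complex.sel(1))
    then have "A$2$1 * (Re l)\<^sup>2 + (A$2$2 - A$1$1) * Re l - A$1$2 = 0" if "A \<in> G" for A
      using that by (simp add: fixform_def power2_eq_square)
    moreover have "(vector [Re l, 1] :: real^2) \<noteq> 0" by (simp add: vec_eq_iff forall_2)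
    ultimately show False
      using no_common_eigenvector[of "vector [Re l, 1]"]
      by (fastforce simp: matrix_vector_mult_2 power2_eq_square algebra_simps)
  qed
  define S where "S = closure (range \<zeta>)"
  have S: "compact S" using bdd by (simp add: S_def)
  have "S \<subseteq> {z. Im z \<ge> \<epsilon>}"
    unfolding S_def using \<epsilon>(2) by (intro closure_minimal closed_halfspace_Im_ge) auto
  then have S_pos: "Im z > 0" if "z \<in> S" for z using that \<epsilon>(1) by force
  have contf: "continuous_on S f"
    by (rule continuous_on_subset[OF holomorphic_on_imp_continuous_on[OF holo]]) (use S_pos in auto)
  have fS: "f z \<in> S" if "z \<in> S" for z
  proof -
    have "f ` closure (range \<zeta>) \<subseteq> S"
    proof (rule image_closure_subset)
      have "f (\<zeta> n) = \<zeta> (Suc n)" for n by (simp add: \<zeta>_def)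
      then have "f ` range \<zeta> \<subseteq> range \<zeta>" by auto
      then show "f ` range \<zeta> \<subseteq> S" unfolding S_def using closure_subset by blast
    qed (use contf in \<open>auto simp: S_def\<close>)
    with that show ?thesis by (auto simp: S_def)
  qed
  have "continuous_on S (\<lambda>z. hyp_gap (f z) z)"
    unfolding hyp_gap_def using S_pos maps
    by (intro continuous_intros contf) (metis less_irrefl mult_eq_0_iff)
  moreover have "S \<noteq> {}" by (simp add: S_def)
  ultimately obtain p where p: "p \<in> S" "\<And>z. z \<in> S \<Longrightarrow> hyp_gap (f p) p \<le> hyp_gap (f z) z"
    using continuous_attains_inf[OF S] by blast
  have "f p = p"
  proof (rule ccontr)
    assume ne: "f p \<noteq> p"
    have pos: "Im p > 0" "Im (f p) > 0" using p(1) S_pos maps by auto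
    \<comment> \<open>The point \<open>f p\<close> lies in \<open>S\<close> too, so minimality at
      \<open>p\<close> excludes a strict decrease of the gap.\<close>
    have "hyp_gap (f (f p)) (f p) = hyp_gap (f p) p"
      using Schwarz_Pick_hyp_gap(1)[OF holo maps pos] p(2)[OF fS[OF p(1)]] by simp
    then obtain \<alpha> where "\<And>\<zeta>. Im \<zeta> > 0 \<Longrightarrow> (f \<zeta> - f p) * (\<zeta> - cnj p) = \<alpha> * (\<zeta> - p) * (f \<zeta> - cnj (f p))"
      using Schwarz_Pick_hyp_gap(2)[OF holo maps pos ne] by blast
    moreover have "Im (f z) \<noteq> 0" if "Im z > 0" for z using maps[OF that] by simp
    ultimately show False
      using equivariant_cayley_form_fixes[of f p \<alpha>] equiv pos(1) ne by blast
  qed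
  then show ?thesis
    using equivariant_self_map_with_fixed_point[OF holo maps equiv S_pos[OF p(1)]] z by blast
qed

text \<open>The reflection \<open>cnj \<circ> h\<close> would be an involution by the previous lemma, hence \<open>- h\<close> would be
  an isometry.\<close>

lemma no_equivariant_map_to_lower_half_plane:
  assumes holo: "h holomorphic_on {z. Im z > 0}"
    and maps: "\<And>z. Im z > 0 \<Longrightarrow> Im (h z) < 0"
    and equiv: "\<And>A z. A \<in> G \<Longrightarrow> Im z > 0 \<Longrightarrow> h (act A z) = act A (h z)"
  shows False
proof -
  define g where "g z = cnj (h z)" for z
  have g: "Im (g z) > 0" if "Im z > 0" for z using maps[OF that] by (simp add: g_def)
  have g_equiv: "g (act A z) = act A (g z)" if "A \<in> G" "Im z > 0" for A z
    using equiv[OF that] by (simp add: g_def act_cnj)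
  \<comment> \<open>The map \<open>- h\<close> is \<open>g\<close> followed by the reflection in the
    imaginary axis, so it is a holomorphic self-map with the same gaps as \<open>g\<close>.\<close>
  have holk: "(\<lambda>z. - h z) holomorphic_on {z. Im z > 0}" by (intro holomorphic_intros holo)
  have k: "Im (- h z) > 0" if "Im z > 0" for z using maps[OF that] by simp
  have gap: "hyp_gap (g z) (g w) = hyp_gap (- h z) (- h w)" for z w
  proof -
    have "cmod (g z - g w) = cmod (h z - h w)"
      unfolding g_def by (metis complex_cnj_diff complex_mod_cnj)
    also have "\<dots> = cmod (- h z - - h w)" by (simp add: norm_minus_commute)
    finally show ?thesis by (simp add: hyp_gap_def g_def)
  qed
  have "(cnj \<circ> h \<circ> cnj) holomorphic_on {z. Im z < 0}"
  proof (rule holomorphic_on_compose_cnj_cnj)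
    have "cnj ` {z. Im z < 0} = {z. Im z > 0}"
      unfolding image_cnj_conv_vimage_cnj by auto
    then show "h holomorphic_on cnj ` {z. Im z < 0}" using holo by simp
  qed (rule open_halfspace_Im_lt)
  then have "((cnj \<circ> h \<circ> cnj) \<circ> h) holomorphic_on {z. Im z > 0}"
    using maps by (intro holomorphic_on_compose_gen[OF holo]) auto
  then have "(\<lambda>z. g (g z)) holomorphic_on {z. Im z > 0}" by (simp add: g_def o_def)
  then have gg: "g (g z) = z" if "Im z > 0" for z
    using equivariant_self_map_eq_id[of "\<lambda>z. g (g z)"] g g_equiv that by simp
  \<comment> \<open>Any two distinct points would serve: \<open>g\<close> does not increase gaps and
    is its own inverse, so it preserves them.\<close>
  have "hyp_gap (- h (2 * \<i>)) (- h \<i>) = hyp_gap (2 * \<i>) \<i>"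
  proof (rule antisym)
    show "hyp_gap (- h (2 * \<i>)) (- h \<i>) \<le> hyp_gap (2 * \<i>) \<i>"
      by (rule Schwarz_Pick_hyp_gap(1)[OF holk k]) simp_all
    have "hyp_gap (2 * \<i>) \<i> = hyp_gap (g (g (2 * \<i>))) (g (g \<i>))" by (simp add: gg)
    also have "\<dots> = hyp_gap (- h (g (2 * \<i>))) (- h (g \<i>))" by (rule gap)
    also have "\<dots> \<le> hyp_gap (g (2 * \<i>)) (g \<i>)"
      by (rule Schwarz_Pick_hyp_gap(1)[OF holk k]) (auto intro: g)
    also have "\<dots> = hyp_gap (- h (2 * \<i>)) (- h \<i>)" by (rule gap)
    finally show "hyp_gap (2 * \<i>) \<i> \<le> hyp_gap (- h (2 * \<i>)) (- h \<i>)" .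
  qed
  then obtain \<alpha> where \<alpha>: "\<And>\<zeta>. Im \<zeta> > 0 \<Longrightarrow>
      (- h \<zeta> - - h \<i>) * (\<zeta> - cnj \<i>) = \<alpha> * (\<zeta> - \<i>) * (- h \<zeta> - cnj (- h \<i>))"
    using Schwarz_Pick_hyp_gap(2)[OF holk k, of \<i> "2 * \<i>"] by (auto simp: complex_eq_iff)
  \<comment> \<open>The signs cancel, so \<open>h\<close> satisfies the identity with the same
    \<open>\<alpha>\<close>. Its values lie in the lower half-plane, and
    \<open>equivariant_cayley_form_fixes\<close> is stated for nonreal values to admit this.\<close>
  have "(h \<zeta> - h \<i>) * (\<zeta> - cnj \<i>) = \<alpha> * (\<zeta> - \<i>) * (h \<zeta> - cnj (h \<i>))" if "Im \<zeta> > 0" for \<zeta>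
    using \<alpha>[OF that] unfolding complex_cnj_minus by algebra
  moreover have "Im (h z) \<noteq> 0" if "Im z > 0" for z using maps[OF that] by simp
  ultimately have "h \<i> = \<i>"
    using equivariant_cayley_form_fixes[of h \<i> \<alpha>] equiv by simp
  then show False using maps[of \<i>] by simp
qed

end

section \<open>Fuchsian groups\<close>

text \<open>The full preimage of the group among the determinant 1 matrices: both signs of every
  element belong to it.\<close>

definition matrix_lift :: "(real^2^2) set set \<Rightarrow> (real^2^2) set" where
  "matrix_lift \<Gamma> = {A. det A = 1 \<and> {A, - A} \<in> \<Gamma>}"

lemma matrix_mult_uminus:
  "(- A) ** B = - (A ** B)" "A ** (- B) = - (A ** B)" for A B :: "real^2^2"
  by (simp_all add: matrix_eq_2 matrix_mult_2)

lemma PSL2R_mult: "{A, - A} \<otimes>\<^bsub>PSL2R\<^esub> {B, - B} = {A ** B, - (A ** B)}"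
  by (auto simp: PSL2R_def FactGroup_def set_mult_def SL2R_def matrix_mult_uminus)

lemma PSL2R_one: "\<one>\<^bsub>PSL2R\<^esub> = {mat 1, - mat 1}"
  by (simp add: PSL2R_def FactGroup_def)

lemma PSL2R_inv:
  assumes "det A = 1"
  shows "inv\<^bsub>PSL2R\<^esub> {A, - A} = {adjugate A, - adjugate A}"
proof (rule group.inv_equality[OF group_PSL2R])
  show "{adjugate A, - adjugate A} \<otimes>\<^bsub>PSL2R\<^esub> {A, - A} = \<one>\<^bsub>PSL2R\<^esub>"
    unfolding PSL2R_mult PSL2R_one adjugate_mult(2)[OF assms] ..
qed (use assms in \<open>auto simp: carrier_PSL2R SL2R_def\<close>)

lemma psl_act_eq_mobius: "psl_act {A, - A} x = mobius A x"
  using psl_act_coset by (simp add: coset_SL2R)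

lemma mobius_Some: "den A z \<noteq> 0 \<Longrightarrow> mobius A (Some z) = Some (act A z)"
  by (simp add: mobius_def act_def den_def moebius_def)

text \<open>Preimages of an arbitrary \<open>w\<close> on the sphere are found by undoing a group
  element, and this has to cover \<open>w = None\<close>, which \<open>act\<close> cannot
  represent.\<close>

lemma mobius_adjugate:
  assumes A: "det A = 1" and w: "mobius A w = Some y"
  shows "mobius (adjugate A) (Some y) = w"
proof -
  have d: "of_real (A$1$1) * of_real (A$2$2) - of_real (A$1$2) * of_real (A$2$1) = (1::complex)"
    using arg_cong[OF A, of complex_of_real] by (simp add: det_2)
  show ?thesis
  proof (cases w)
    case None
    with w show ?thesis by (auto simp: mobius_def split: if_splits)
  next
    case (Some z)
    with w have nz: "den A z \<noteq> 0" by (auto simp: mobius_def den_def split: if_splits)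
    with w Some have y: "y = act A z" by (simp add: mobius_Some)
    have "den (adjugate A) y * den A z = - of_real (A$2$1) * (y * den A z) + of_real (A$1$1) * den A z"
      by (simp add: den_def algebra_simps)
    also have "\<dots> = 1"
      unfolding y act_times_den[OF nz] unfolding den_def using d by algebra
    finally have nz': "den (adjugate A) y \<noteq> 0" by auto
    then have "mobius (adjugate A) (Some y) = Some (act (adjugate A ** A) z)"
      using nz by (simp add: mobius_Some act_mult y)
    then show ?thesis using A by (simp add: adjugate_mult Some)
  qed
qed

lemma norm_matrix_2_le:
  "norm M \<le> \<bar>M$1$1\<bar> + \<bar>M$1$2\<bar> + \<bar>M$2$1\<bar> + \<bar>M$2$2\<bar>" for M :: "real^2^2"
proof -
  have "norm M \<le> norm (M$1) + norm (M$2)"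
    using L2_set_le_sum[of UNIV "\<lambda>i. norm (M$i)"] by (simp add: norm_vec_def sum_2)
  then show ?thesis
    using norm_le_l1_cart[of "M$1"] norm_le_l1_cart[of "M$2"] by (simp add: sum_2)
qed

lemma fuchsian_group_identity_isolated:
  assumes "fuchsian_group \<Gamma>"
  obtains e where "e > 0"
    "\<And>A. A \<in> matrix_lift \<Gamma> \<Longrightarrow> norm (A - mat 1) < e \<Longrightarrow> A = mat 1 \<or> A = - mat 1"
proof -
  have sub: "subgroup \<Gamma> PSL2R"
    and disc: "subtopology PSL2R_topology \<Gamma> = discrete_topology \<Gamma>"
    using assms by (auto simp: fuchsian_group_def)
  have one: "{mat 1, - mat 1} \<in> \<Gamma>"
    using subgroup.one_closed[OF sub] by (simp add: PSL2R_one)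
  then have "openin (subtopology PSL2R_topology \<Gamma>) {{mat 1, - mat 1}}" by (simp add: disc)
  then obtain U where U: "openin PSL2R_topology U" "{{mat 1, - mat 1}} = U \<inter> \<Gamma>"
    by (auto simp: openin_subtopology)
  then have Uc: "U \<subseteq> carrier PSL2R" and op: "openin (top_of_set (carrier SL2R)) (\<Union>U)"
    by (auto simp: openin_PSL2R_topology)
  have "mat 1 \<in> \<Union>U" using U(2) by auto
  then obtain e where e: "e > 0" "ball (mat 1) e \<inter> carrier SL2R \<subseteq> \<Union>U"
    using op unfolding openin_contains_ball by blast
  show ?thesis
  proof (rule that[OF e(1)])
    fix A assume A: "A \<in> matrix_lift \<Gamma>" "norm (A - mat 1) < e"
    then have "A \<in> \<Union>U"
      using e(2) by (auto simp: matrix_lift_def SL2R_def dist_norm norm_minus_commute subset_iff)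
    then obtain P where P: "P \<in> U" "A \<in> P" by blast
    then have "P = {A, - A}" using Uc by (auto simp: carrier_PSL2R)
    with P A(1) have "P \<in> U \<inter> \<Gamma>" by (simp add: matrix_lift_def)
    with U(2) P(2) show "A = mat 1 \<or> A = - mat 1" by auto
  qed
qed

text \<open>Discreteness at the identity spreads to all bounded sets: inverses of bounded
  determinant 1 matrices are equally bounded, so two nearby elements \<open>A\<close>,
  \<open>B\<close> have \<open>adjugate A ** B\<close> close to \<open>mat 1\<close>, and
  \<open>B\<close> is \<open>A\<close> or \<open>- A\<close>.\<close>

lemma fuchsian_first_kind_matrix_group:
  assumes F: "fuchsian_group \<Gamma>" and first: "first_kind \<Gamma>"
  shows "first_kind_matrix_group (matrix_lift \<Gamma>)"
proof
  have sub: "subgroup \<Gamma> PSL2R" using F by (simp add: fuchsian_group_def)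
  let ?G = "matrix_lift \<Gamma>"
  show det: "det A = 1" if "A \<in> ?G" for A using that by (simp add: matrix_lift_def)
  show mult: "A ** B \<in> ?G" if "A \<in> ?G" "B \<in> ?G" for A B
    using that subgroup.m_closed[OF sub, of "{A, - A}" "{B, - B}"]
    by (simp add: matrix_lift_def PSL2R_mult det_mul)
  show adj: "adjugate A \<in> ?G" if "A \<in> ?G" for A
    using that subgroup.m_inv_closed[OF sub, of "{A, - A}"]
    by (simp add: matrix_lift_def PSL2R_inv)
  show "finite {A \<in> ?G. \<forall>i j. \<bar>A$i$j\<bar> \<le> R}" for R
  proof (rule ccontr)
    let ?K = "{A \<in> ?G. \<forall>i j. \<bar>A$i$j\<bar> \<le> R}"
    assume inf: "infinite ?K"
    then obtain A where "A \<in> ?K" using infinite_imp_nonempty by blast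
    then have "\<bar>A$1$1\<bar> \<le> R" by blast
    then have R: "R \<ge> 0" by linarith
    have "norm A \<le> R + R + R + R" if "A \<in> ?K" for A
      using that by (intro order_trans[OF norm_matrix_2_le] add_mono) auto
    then have "bounded ?K" unfolding bounded_iff by blast
    then obtain L where L: "L islimpt ?K" using bounded_infinite_imp_islimpt[OF order_refl _ inf] by blast
    obtain e where e: "e > 0"
      "\<And>A. A \<in> ?G \<Longrightarrow> norm (A - mat 1) < e \<Longrightarrow> A = mat 1 \<or> A = - mat 1"
      using fuchsian_group_identity_isolated[OF F] by blast
    \<comment> \<open>Entries of \<open>B - A\<close> are at most \<open>2 * \<eta>\<close>, those
      of \<open>adjugate A ** (B - A)\<close> at most \<open>4 * R * \<eta>\<close>, and the four
      entries together at most \<open>16 * R * \<eta>\<close>. The 1 added to \<open>R\<close>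
      avoids a zero denominator.\<close>
    define \<eta> where "\<eta> = e / (16 * (R + 1))"
    have \<eta>: "\<eta> > 0" "16 * R * \<eta> < e" using e(1) R by (simp_all add: \<eta>_def field_simps)
    have inf': "infinite (?K \<inter> ball L \<eta>)" using L \<eta>(1) by (simp add: islimpt_eq_infinite_ball)
    then obtain A where A: "A \<in> ?K \<inter> ball L \<eta>" using infinite_imp_nonempty by blast
    have "B \<in> {A, - A}" if B: "B \<in> ?K \<inter> ball L \<eta>" for B
    proof -
      have AG: "A \<in> ?G" "B \<in> ?G" and AR: "\<bar>A$i$j\<bar> \<le> R" for i j using A B by auto
      have "norm (B - A) < \<eta> + \<eta>"
        using A B dist_triangle2[of B A L] by (simp add: dist_norm[symmetric] dist_commute)
      then have BA: "\<bar>(B - A)$i$j\<bar> \<le> 2 * \<eta>" for i j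
        using abs_matrix_nth_le_norm[of "B - A" i j] by linarith
      have aR: "\<bar>adjugate A$i$j\<bar> \<le> R" for i j
        using AR exhaust_2[of i] exhaust_2[of j] by auto
      have diff: "adjugate A ** B - mat 1 = adjugate A ** (B - A)"
        unfolding adjugate_mult(2)[OF det[OF AG(1)], symmetric]
        by (simp add: matrix_eq_2 matrix_mult_2 algebra_simps)
      have "\<bar>(adjugate A ** (B - A))$i$j\<bar> \<le> 4 * R * \<eta>" for i j
      proof -
        have "\<bar>(adjugate A ** (B - A))$i$j\<bar> \<le>
            \<bar>adjugate A$i$1\<bar> * \<bar>(B - A)$1$j\<bar> + \<bar>adjugate A$i$2\<bar> * \<bar>(B - A)$2$j\<bar>"
          unfolding matrix_mult_2 abs_mult[symmetric] by (rule abs_triangle_ineq)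
        also have "\<dots> \<le> R * (2 * \<eta>) + R * (2 * \<eta>)"
          by (intro add_mono mult_mono aR BA R abs_ge_zero)
        finally show ?thesis by simp
      qed
      then have "norm (adjugate A ** B - mat 1) \<le> 4 * R * \<eta> + 4 * R * \<eta> + 4 * R * \<eta> + 4 * R * \<eta>"
        unfolding diff by (intro order_trans[OF norm_matrix_2_le] add_mono)
      also have "\<dots> < e" using \<eta>(2) by simp
      finally have "adjugate A ** B = mat 1 \<or> adjugate A ** B = - mat 1"
        by (intro e(2) mult adj AG)
      moreover have "A ** (adjugate A ** B) = B"
        by (simp add: matrix_mul_assoc adjugate_mult det AG)
      ultimately show ?thesis by (auto simp: matrix_mult_uminus)
    qed
    then have "?K \<inter> ball L \<eta> \<subseteq> {A, - A}" by blast
    with inf' show False by (meson finite.emptyI finite.insertI finite_subset)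
  qed
  fix x :: real
  have "Some (complex_of_real x) \<in> limit_set \<Gamma>"
    using first by (auto simp: first_kind_def extended_reals_def)
  then obtain z where z: "Im z > 0"
    "Some (complex_of_real x) \<in> sphere_topology derived_set_of ((\<lambda>\<gamma>. psl_act \<gamma> (Some z)) ` \<Gamma>)"
    by (auto simp: limit_set_def upper_half_plane_def)
  have "\<exists>A\<in>?G. cmod (act A z - of_real x) < e" if "e > 0" for e
  proof -
    have "openin sphere_topology (Some ` ball (complex_of_real x) e)" by simp
    moreover have "Some (complex_of_real x) \<in> Some ` ball (complex_of_real x) e" using that by simp
    ultimately obtain \<gamma> where \<gamma>: "\<gamma> \<in> \<Gamma>" "psl_act \<gamma> (Some z) \<in> Some ` ball (complex_of_real x) e"
      using z(2) unfolding in_derived_set_of by blast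
    have "\<gamma> \<in> carrier PSL2R" using \<gamma>(1) subgroup.subset[OF sub] by blast
    then obtain A where A: "det A = 1" "\<gamma> = {A, - A}" by (auto simp: carrier_PSL2R SL2R_def)
    have "psl_act \<gamma> (Some z) = Some (act A z)"
      unfolding A(2) psl_act_eq_mobius using A(1) z(1) by (intro mobius_Some den_nonzero) auto
    with \<gamma> A show ?thesis
      by (intro bexI[of _ A]) (auto simp: matrix_lift_def dist_norm norm_minus_commute)
  qed
  then show "\<exists>z. Im z > 0 \<and> (\<forall>e>0. \<exists>A\<in>?G. cmod (act A z - of_real x) < e)" using z(1) by blast
qed

section \<open>Proper discontinuity, choice of representatives, and poles\<close>

text \<open>The formula for \<open>Im (act A z)\<close> bounds \<open>den A z\<close>, hence also
  the numerator \<open>act A z * den A z\<close>. Both are linear forms \<open>s * z + t\<close>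
  with real \<open>s\<close>, \<open>t\<close>, and these coefficients are recovered because
  \<open>Im z \<ge> m\<close>.\<close>

lemma (in first_kind_matrix_group) finite_return_elements:
  assumes m: "m > 0" and U: "\<And>z. z \<in> U \<Longrightarrow> Im z \<ge> m" "\<And>z. z \<in> U \<Longrightarrow> cmod z \<le> M"
  shows "finite {A \<in> G. \<exists>z\<in>U. act A z \<in> U}"
proof -
  define q where "q = sqrt (M / m)"
  \<comment> \<open>The summands bound \<open>A$2$1\<close>, \<open>A$2$2\<close>,
    \<open>A$1$1\<close> and \<open>A$1$2\<close>, in this order.\<close>
  define R where "R = q / m + (q + q / m * M) + M * q / m + (M * q + M * q / m * M)"
  have "\<bar>A$i$j\<bar> \<le> R" if A: "A \<in> G" and z: "z \<in> U" "act A z \<in> U" for A z i j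
  proof -
    have Imz: "Im z > 0" using U(1)[OF z(1)] m by simp
    have nz: "den A z \<noteq> 0" using den_nonzero[OF det[OF A]] Imz by simp
    have M: "M \<ge> 0" using U(2)[OF z(1)] norm_ge_zero order_trans by blast
    have q: "q \<ge> 0" using M m by (simp add: q_def)
    have "m * (cmod (den A z))\<^sup>2 \<le> Im (act A z) * (cmod (den A z))\<^sup>2"
      using U(1)[OF z(2)] by (intro mult_right_mono) auto
    also have "\<dots> = Im z" using nz Imz by (simp add: Im_act det A)
    also have "\<dots> \<le> M" using U(2)[OF z(1)] abs_Im_le_cmod[of z] by linarith
    finally have "(cmod (den A z))\<^sup>2 \<le> M / m" using m by (simp add: field_simps)
    then have den: "cmod (den A z) \<le> q" unfolding q_def by (rule real_le_rsqrt)
    have bound: "\<bar>s\<bar> \<le> B / m" "\<bar>t\<bar> \<le> B + B / m * M"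
      if B: "cmod (of_real s * z + of_real t) \<le> B" for s t B :: real
    proof -
      have "\<bar>s\<bar> * m \<le> \<bar>s\<bar> * Im z" using U(1)[OF z(1)] by (intro mult_left_mono) auto
      also have "\<dots> = \<bar>Im (of_real s * z + of_real t)\<bar>" using Imz by (simp add: abs_mult)
      also have "\<dots> \<le> B" using abs_Im_le_cmod B order_trans by blast
      finally show s: "\<bar>s\<bar> \<le> B / m" using m by (simp add: field_simps)
      have "\<bar>t\<bar> = cmod ((of_real s * z + of_real t) - of_real s * z)" by simp
      also have "\<dots> \<le> B + \<bar>s\<bar> * cmod z"
        using B by (intro order_trans[OF norm_triangle_ineq4]) (simp add: norm_mult)
      also have "\<dots> \<le> B + B / m * M"
        using s U(2)[OF z(1)] M by (intro add_left_mono mult_mono) auto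
      finally show "\<bar>t\<bar> \<le> B + B / m * M" .
    qed
    have "cmod (of_real (A$1$1) * z + of_real (A$1$2)) = cmod (act A z) * cmod (den A z)"
      using act_times_den[OF nz] by (metis norm_mult)
    also have "\<dots> \<le> M * q" using U(2)[OF z(2)] den M by (intro mult_mono) auto
    finally have num: "cmod (of_real (A$1$1) * z + of_real (A$1$2)) \<le> M * q" .
    have nonneg: "q / m \<ge> 0" "q / m * M \<ge> 0" "M * q / m \<ge> 0" "M * q / m * M \<ge> 0" "M * q \<ge> 0"
      using q m M by auto
    have "\<bar>A$1$1\<bar> \<le> R" "\<bar>A$1$2\<bar> \<le> R" "\<bar>A$2$1\<bar> \<le> R" "\<bar>A$2$2\<bar> \<le> R"
      using bound[OF num] bound[OF den[unfolded den_def]] nonneg q unfolding R_def by linarith+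
    then show ?thesis using exhaust_2[of i] exhaust_2[of j] by auto
  qed
  then have "{A \<in> G. \<exists>z\<in>U. act A z \<in> U} \<subseteq> {A \<in> G. \<forall>i j. \<bar>A$i$j\<bar> \<le> R}" by blast
  then show ?thesis using finite_bounded finite_subset by blast
qed

text \<open>An infinite set is not a finite union of finite classes. Here \<open>f\<close> sends a
  point to its class and \<open>T\<close> contains one representative of each.\<close>

lemma infinite_inequivalent_subset:
  assumes Y: "infinite Y"
    and refl: "\<And>y. y \<in> Y \<Longrightarrow> E y y"
    and sym: "\<And>x y. x \<in> Y \<Longrightarrow> y \<in> Y \<Longrightarrow> E x y \<Longrightarrow> E y x"
    and trans: "\<And>x y z. x \<in> Y \<Longrightarrow> y \<in> Y \<Longrightarrow> z \<in> Y \<Longrightarrow> E x y \<Longrightarrow> E y z \<Longrightarrow> E x z"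
    and fin: "\<And>y. y \<in> Y \<Longrightarrow> finite {z \<in> Y. E y z}"
  shows "\<exists>T\<subseteq>Y. infinite T \<and> pairwise (\<lambda>x y. \<not> E x y) T"
proof -
  define f where "f y = {z \<in> Y. E y z}" for y
  obtain T where T: "T \<subseteq> Y" "inj_on f T" "f ` Y = f ` T"
    using subset_image_inj[of "f ` Y" f Y] by auto
  have "Y \<subseteq> \<Union>(f ` Y)" using refl by (auto simp: f_def)
  moreover have "finite B" if "B \<in> f ` Y" for B using that fin by (auto simp: f_def)
  ultimately have "infinite (f ` Y)" using Y finite_Union finite_subset by metis
  then have "infinite T" unfolding T(3) by auto
  moreover have "pairwise (\<lambda>x y. \<not> E x y) T"
  proof (rule pairwiseI, rule notI)
    fix x y assume xy: "x \<in> T" "y \<in> T" "x \<noteq> y" "E x y"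
    then have "f x = f y" using T(1) sym trans unfolding f_def by blast
    with xy T(2) show False by (auto dest: inj_onD)
  qed
  ultimately show ?thesis using T(1) by blast
qed

text \<open>The reciprocal of \<open>h\<close> extends holomorphically by 0 across the pole and is
  open there, so it takes a small positive real value; this is attained away from the pole
  itself.\<close>

lemma pole_imp_real_value:
  assumes mero: "h nicely_meromorphic_on S" and S: "open S" "p \<in> S" and pole: "is_pole h p"
  shows "\<exists>z\<in>S. \<not> is_pole h z \<and> Im (h z) = 0"
proof -
  have "h meromorphic_on {p}"
    using mero S by (auto simp: nicely_meromorphic_on_def intro: meromorphic_on_subset)
  then have "isolated_singularity_at h p" by (simp add: meromorphic_on_isolated_singularity)
  then obtain r where r: "r > 0" "h analytic_on ball p r - {p}" by (auto simp: isolated_singularity_at_def)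
  have "\<forall>\<^sub>F z in at p. h z \<noteq> 0" using pole by (rule non_zero_neighbour_pole)
  then obtain s where s: "s > 0" "\<And>z. z \<noteq> p \<Longrightarrow> dist z p < s \<Longrightarrow> h z \<noteq> 0"
    by (auto simp: eventually_at)
  obtain t where t: "t > 0" "ball p t \<subseteq> S" using S by (meson open_contains_ball)
  define d where "d = Min {r, s, t}"
  have d: "d > 0" "d \<le> r" "d \<le> s" "d \<le> t" using r s t by (auto simp: d_def)
  define g where "g z = (if z = p then 0 else inverse (h z))" for z
  have holh: "h holomorphic_on ball p d - {p}"
    using r(2) d by (auto intro!: analytic_imp_holomorphic analytic_on_subset[OF r(2)])
  have nz: "h z \<noteq> 0" if "z \<in> ball p d - {p}" for z using s(2)[of z] that d by (auto simp: dist_commute)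
  have "g holomorphic_on ball p d"
    unfolding g_def using holh pole nz by (intro is_pole_inverse_holomorphic) auto
  moreover have "\<not> g constant_on ball p d"
  proof
    assume "g constant_on ball p d"
    moreover have "p \<in> ball p d" "p + of_real (d / 2) \<in> ball p d" using d by (auto simp: dist_norm)
    ultimately have "g (p + of_real (d / 2)) = g p" unfolding constant_on_def by metis
    then show False using nz[of "p + of_real (d / 2)"] d by (auto simp: g_def dist_norm)
  qed
  ultimately have "open (g ` ball p d)" by (intro open_mapping_thm) auto
  moreover have "0 \<in> g ` ball p d" using d by (auto simp: g_def intro!: image_eqI[of _ _ p])
  ultimately obtain k where k: "k > 0" "ball 0 k \<subseteq> g ` ball p d" by (meson open_contains_ball)
  have "complex_of_real (k / 2) \<in> ball 0 k" using k by simp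
  then have "complex_of_real (k / 2) \<in> g ` ball p d" using k(2) by blast
  then obtain z where z: "z \<in> ball p d" "g z = of_real (k / 2)" by (metis imageE)
  have zp: "z \<noteq> p" using z k by (auto simp: g_def)
  then have "inverse (h z) = of_real (k / 2)" using z by (simp add: g_def)
  then have "h z = of_real (inverse (k / 2))" by (metis inverse_inverse_eq of_real_inverse)
  then have "Im (h z) = 0" by simp
  moreover have "\<not> is_pole h z"
    using z zp by (intro not_is_pole_holomorphic[OF _ _ holh]) auto
  moreover have "z \<in> S" using z(1) t(2) d by (auto simp: subset_iff)
  ultimately show ?thesis by blast
qed

lemma (in first_kind_matrix_group) one_closed: "mat 1 \<in> G"
proof -
  obtain A where "A \<in> G" using noncommutative by blast
  then show ?thesis using mult_closed[OF adjugate_closed] adjugate_mult(2) det by metis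
qed

lemma equivalent_points_iff:
  assumes "subgroup \<Gamma> PSL2R" "Im z > 0"
  shows "equivalent_points \<Gamma> z w \<longleftrightarrow> (\<exists>A\<in>matrix_lift \<Gamma>. w = act A z)"
proof -
  have act: "psl_act_uhp {A, - A} z = act A z" if "det A = 1" for A
    using den_nonzero[OF that, of z] assms(2) by (simp add: psl_act_uhp_def psl_act_eq_mobius mobius_Some)
  have "\<Gamma> \<subseteq> carrier PSL2R" using subgroup.subset[OF assms(1)] .
  then have "\<exists>A. det A = 1 \<and> \<gamma> = {A, - A}" if "\<gamma> \<in> \<Gamma>" for \<gamma>
    using that by (auto simp: carrier_PSL2R SL2R_def)
  then show ?thesis
    unfolding equivalent_points_def matrix_lift_def using act by (metis (mono_tags, lifting) mem_Collect_eq)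
qed

section \<open>A real value of \<open>h\<close> and the inequivalent preimages\<close>

theorem theorem10p1:
  fixes \<Gamma> :: "(real^2^2) set set" and h :: "complex \<Rightarrow> complex"
  assumes "fuchsian_group \<Gamma>" and "first_kind \<Gamma>"
    and "equivariant_function \<Gamma> h"
    and "\<exists>z\<in>upper_half_plane. sphere_map h z \<noteq> Some z"
  shows "(\<forall>w::riemann_sphere.
            infinitely_many_inequivalent \<Gamma> {z \<in> upper_half_plane. sphere_map h z = w})
         \<and> infinitely_many_inequivalent \<Gamma> {z \<in> upper_half_plane. is_pole h z}"
proof -
  define H where "H = {z. Im z > 0}"
  have uhp: "upper_half_plane = H" by (simp add: H_def upper_half_plane_def)
  have H: "open H" "connected H"
    by (simp_all add: H_def open_halfspace_Im_gt convex_halfspace_Im_gt convex_connected)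
  define G where "G = matrix_lift \<Gamma>"
  interpret first_kind_matrix_group G
    unfolding G_def by (rule fuchsian_first_kind_matrix_group[OF assms(1,2)])
  have sub: "subgroup \<Gamma> PSL2R" using assms(1) by (simp add: fuchsian_group_def)
  have nice: "h nicely_meromorphic_on H"
    using assms(3) by (simp add: equivariant_function_def uhp)
  have equiv: "sphere_map h (act A z) = mobius A (sphere_map h z)" if "A \<in> G" "Im z > 0" for A z
  proof -
    have "{A, - A} \<in> \<Gamma>" using that by (simp add: G_def matrix_lift_def)
    moreover have "psl_act_uhp {A, - A} z = act A z"
      using den_nonzero[OF det[OF that(1)], of z] that(2)
      by (simp add: psl_act_uhp_def psl_act_eq_mobius mobius_Some)
    ultimately show ?thesis
      using assms(3) that(2) by (force simp: equivariant_function_def uhp H_def psl_act_eq_mobius)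
  qed
  have analytic: "h analytic_on {z}" if "z \<in> H" "\<not> is_pole h z" for z
    using nicely_meromorphic_on_imp_analytic_at[OF nice that] .

  have "\<exists>z\<in>H. \<not> is_pole h z \<and> Im (h z) = 0"
  proof (rule ccontr)
    assume no: "\<not> ?thesis"
    then have nopole: "\<not> is_pole h z" if "z \<in> H" for z
      using pole_imp_real_value[OF nice H(1)] that by blast
    then have nonreal: "Im (h z) \<noteq> 0" if "Im z > 0" for z using no that by (auto simp: H_def)
    have "h analytic_on H" using analytic nopole analytic_on_analytic_at by blast
    then have holo: "h holomorphic_on H" by (rule analytic_imp_holomorphic)
    have heq: "h (act A z) = act A (h z)" if "A \<in> G" "Im z > 0" for A z
    proof -
      have "sphere_map h z = Some (h z)" "sphere_map h (act A z) = Some (h (act A z))"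
        using nopole that Im_act_pos[OF det] by (auto simp: sphere_map_def H_def)
      then show ?thesis
        using equiv[OF that] mobius_Some[OF den_nonzero[OF det[OF that(1)] nonreal[OF that(2)]]] by simp
    qed
    have conn: "connected ((\<lambda>z. Im (h z)) ` H)"
      using H(2) by (intro connected_continuous_image continuous_intros holomorphic_on_imp_continuous_on holo)
    have "(\<forall>z\<in>H. Im (h z) > 0) \<or> (\<forall>z\<in>H. Im (h z) < 0)"
    proof (rule ccontr)
      assume "\<not> ?thesis"
      then obtain a b where "a \<in> H" "b \<in> H" "Im (h a) \<le> 0" "Im (h b) \<ge> 0" by (meson not_le)
      then have "0 \<in> (\<lambda>z. Im (h z)) ` H"
        using conn[unfolded connected_iff_interval] by blast
      then show False using nonreal by (auto simp: H_def)
    qed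
    then show False
    proof
      assume "\<forall>z\<in>H. Im (h z) > 0"
      then have "h z = z" if "z \<in> H" for z
        using equivariant_self_map_eq_id[of h z] holo heq that by (simp add: H_def)
      then show False using assms(4) nopole by (auto simp: uhp sphere_map_def)
    next
      assume "\<forall>z\<in>H. Im (h z) < 0"
      then show False
        using no_equivariant_map_to_lower_half_plane[of h] holo heq by (simp add: H_def)
    qed
  qed
  then obtain z0 where z0: "z0 \<in> H" "\<not> is_pole h z0" "Im (h z0) = 0" by blast
  define x where "x = Re (h z0)"
  have x: "h z0 = of_real x" using z0(3) by (simp add: x_def complex_eq_iff)

  obtain T where T: "open T" "z0 \<in> T" "h holomorphic_on T"
    using analytic[OF z0(1,2)] by (auto simp: analytic_at)
  then have "open (T \<inter> H)" "z0 \<in> T \<inter> H" using H(1) z0(1) by auto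
  \<comment> \<open>A closed disc inside the half-plane keeps imaginary parts away from 0, as
    \<open>finite_return_elements\<close> requires.\<close>
  then obtain r where r: "r > 0" "cball z0 r \<subseteq> T \<inter> H" by (meson open_contains_cball)
  define U where "U = ball z0 r"
  have U: "open U" "connected U" "z0 \<in> U" "U \<subseteq> T" "U \<subseteq> H" "U \<subseteq> cball z0 r"
    using r by (auto simp: U_def)
  have holU: "h holomorphic_on U" using T(3) U(4) holomorphic_on_subset by blast
  have nopoleU: "\<not> is_pole h z" if "z \<in> U" for z
    using not_is_pole_holomorphic[OF U(1) that holU] .
  \<comment> \<open>A constant value \<open>x\<close> would extend to all of the half-plane and, by
    equivariance, be fixed by the whole group, whereas its orbit is infinite.\<close>
  have "\<not> h constant_on U"
  proof
    assume "h constant_on U"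
    then have const: "h z = of_real x" if "z \<in> U" for z
      using that U(3) x unfolding constant_on_def by metis
    have "\<forall>\<^sub>F z in at z0. h z = of_real x"
      using eventually_at_in_open'[OF U(1,3)] by eventually_elim (rule const)
    then have "\<exists>\<^sub>F z in at z0. h z = of_real x" by (intro eventually_frequently) auto
    then have hx: "h z = of_real x" if "z \<in> H" for z
      using frequently_eq_meromorphic_imp_constant[OF _ nice H(1,2) z0(1)] that by blast
    have "h holomorphic_on H"
      by (rule holomorphic_transform[OF holomorphic_on_const]) (use hx in auto)
    then have "sphere_map h z = Some (of_real x)" if "z \<in> H" for z
      using not_is_pole_holomorphic[OF H(1) that] hx[OF that] by (simp add: sphere_map_def)
    then have "mobius A (Some (of_real x)) = Some (of_real x)" if "A \<in> G" for A
      using equiv[OF that, of \<i>] Im_act_pos[OF det[OF that], of \<i>] by (simp add: H_def)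
    then have "{y. \<exists>A\<in>G. mobius A (Some (of_real x)) = Some y} \<subseteq> {of_real x}" by auto
    then show False
      using infinite_orbit_near[of 1 "Some (of_real x)" x] by (meson finite.emptyI finite.insertI finite_Int finite_subset zero_less_one)
  qed
  then have "open (h ` U)" using open_mapping_thm[OF holU U(1,2) U(1)] by blast
  moreover have "of_real x \<in> h ` U" using U(3) x by force
  ultimately obtain e where e: "e > 0" "ball (of_real x) e \<subseteq> h ` U" by (meson open_contains_ball)

  have main: "infinitely_many_inequivalent \<Gamma> {z \<in> upper_half_plane. sphere_map h z = w}" for w
  proof -
    define Y where "Y = {y. \<exists>A\<in>G. mobius A w = Some y} \<inter> ball (of_real x) e"
    have "\<forall>y\<in>Y. \<exists>z. z \<in> U \<and> h z = y" using e(2) by (auto simp: Y_def)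
    then obtain Z where Z: "\<And>y. y \<in> Y \<Longrightarrow> Z y \<in> U" "\<And>y. y \<in> Y \<Longrightarrow> h (Z y) = y" by metis
    have "\<forall>y\<in>Y. \<exists>A. A \<in> G \<and> mobius A w = Some y" by (auto simp: Y_def)
    then obtain B where B: "\<And>y. y \<in> Y \<Longrightarrow> B y \<in> G" "\<And>y. y \<in> Y \<Longrightarrow> mobius (B y) w = Some y" by metis
    define u where "u y = act (adjugate (B y)) (Z y)" for y
    have Zpos: "Im (Z y) > 0" if "y \<in> Y" for y using Z(1)[OF that] U(5) by (auto simp: H_def)
    have upos: "Im (u y) > 0" if "y \<in> Y" for y
      unfolding u_def by (intro Im_act_pos det adjugate_closed B Zpos that)
    have u: "sphere_map h (u y) = w" if y: "y \<in> Y" for y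
    proof -
      have "sphere_map h (Z y) = Some y" using nopoleU[OF Z(1)[OF y]] Z(2)[OF y] by (simp add: sphere_map_def)
      then show ?thesis
        using equiv[OF adjugate_closed[OF B(1)[OF y]] Zpos[OF y]] mobius_adjugate[OF det[OF B(1)[OF y]] B(2)[OF y]]
        by (simp add: u_def)
    qed
    \<comment> \<open>Equivalence is transported to the values \<open>y\<close>, since
      \<open>u\<close> is not yet known to be injective; injectivity on \<open>T\<close> will follow
      from inequivalence.\<close>
    define E where "E y y' \<longleftrightarrow> equivalent_points \<Gamma> (u y) (u y')" for y y'
    have E: "E y y' \<longleftrightarrow> (\<exists>A\<in>G. u y' = act A (u y))" if "y \<in> Y" for y y'
      unfolding E_def G_def using equivalent_points_iff[OF sub upos[OF that]] .
    have "\<exists>T\<subseteq>Y. infinite T \<and> pairwise (\<lambda>x y. \<not> E x y) T"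
    proof (rule infinite_inequivalent_subset)
      show "infinite Y" unfolding Y_def by (rule infinite_orbit_near[OF e(1)])
      show "E y y" if "y \<in> Y" for y using E[OF that] one_closed by (auto intro!: bexI[of _ "mat 1"])
      show "E y' y" if yy': "y \<in> Y" "y' \<in> Y" "E y y'" for y y'
      proof -
        obtain A where A: "A \<in> G" "u y' = act A (u y)" using yy' E by blast
        then have "u y = act (adjugate A) (u y')" using act_adjugate(1)[OF det[OF A(1)]] upos[OF that(1)] by simp
        then show ?thesis using E[OF that(2)] adjugate_closed[OF A(1)] by blast
      qed
      show "E y1 y3" if ys: "y1 \<in> Y" "y2 \<in> Y" "y3 \<in> Y" "E y1 y2" "E y2 y3" for y1 y2 y3
      proof -
        obtain A C where A: "A \<in> G" "u y2 = act A (u y1)" "C \<in> G" "u y3 = act C (u y2)"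
          using ys E by blast
        then have "u y3 = act (C ** A) (u y1)"
          using act_mult[OF den_nonzero[OF det[OF A(1)]]] upos[OF that(1)] by simp
        then show ?thesis using E[OF that(1)] mult_closed[OF A(3,1)] by blast
      qed
      show "finite {y' \<in> Y. E y y'}" if y: "y \<in> Y" for y
      proof -
        have "compact (Im ` cball z0 r)" "cball z0 r \<noteq> {}"
          using r(1) by (auto intro!: compact_continuous_image continuous_intros)
        then obtain m where m: "m \<in> Im ` cball z0 r" "\<And>t. t \<in> Im ` cball z0 r \<Longrightarrow> m \<le> t"
          using compact_attains_inf[of "Im ` cball z0 r"] by auto
        have "m > 0" using m(1) r(2) by (auto simp: H_def)
        moreover have "m \<le> Im z" if "z \<in> cball z0 r" for z using m(2) that by auto
        moreover have "cmod z \<le> cmod z0 + r" if "z \<in> cball z0 r" for z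
          using that norm_triangle_sub[of z z0] by (simp add: dist_norm norm_minus_commute)
        ultimately have fin: "finite {A \<in> G. \<exists>z\<in>cball z0 r. act A z \<in> cball z0 r}" (is "finite ?F")
          by (rule finite_return_elements)
        \<comment> \<open>If \<open>u y\<close> and \<open>u y'\<close> are equivalent, so are
          \<open>Z y\<close> and \<open>Z y'\<close>, by an element that returns a point of the disc
          to the disc. There are finitely many such elements, and each determines \<open>y'\<close>
          as the value of \<open>h\<close> at the image of \<open>Z y\<close>.\<close>
        have "{y' \<in> Y. E y y'} \<subseteq> (\<lambda>A. h (act A (Z y))) ` ?F"
        proof
          fix y' assume "y' \<in> {y' \<in> Y. E y y'}"
          then have y': "y' \<in> Y" and "E y y'" by auto
          then obtain A where A: "A \<in> G" "u y' = act A (u y)" using E[OF y] by blast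
          define C where "C = B y' ** (A ** adjugate (B y))"
          have C: "C \<in> G" unfolding C_def by (intro mult_closed adjugate_closed A B y y')
          have AB: "A ** adjugate (B y) \<in> G" by (intro mult_closed adjugate_closed A B y)
          have uy: "act (A ** adjugate (B y)) (Z y) = act A (u y)"
            unfolding u_def using Zpos[OF y] det[OF B(1)[OF y]]
            by (intro act_mult den_nonzero) auto
          have "Z y' = act (B y') (u y')"
            unfolding u_def using act_adjugate(2)[OF det[OF B(1)[OF y']]] Zpos[OF y'] by simp
          also have "u y' = act (A ** adjugate (B y)) (Z y)"
            using A(2) uy by simp
          also have "act (B y') \<dots> = act C (Z y)"
            unfolding C_def using Zpos[OF y] det[OF AB]
            by (intro act_mult[symmetric] den_nonzero) auto
          finally have Zy': "Z y' = act C (Z y)" .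
          have "Z y \<in> cball z0 r" "act C (Z y) \<in> cball z0 r"
            using Z(1)[OF y] Z(1)[OF y'] U(6) unfolding Zy' by blast+
          then have "C \<in> ?F" using C by blast
          moreover have "y' = h (act C (Z y))" using Z(2)[OF y'] Zy' by simp
          ultimately show "y' \<in> (\<lambda>A. h (act A (Z y))) ` ?F" by blast
        qed
        then show ?thesis using fin finite_subset finite_imageI by blast
      qed
    qed
    then obtain T where T: "T \<subseteq> Y" "infinite T" "pairwise (\<lambda>x y. \<not> E x y) T" by blast
    have "inj_on u T"
    proof (rule inj_onI, rule ccontr)
      fix y y' assume y: "y \<in> T" "y' \<in> T" "u y = u y'" "y \<noteq> y'"
      then have "y \<in> Y" "u y' = act (mat 1) (u y)" using T(1) by auto
      then have "E y y'" using E one_closed by blast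
      then show False using T(3) y by (auto simp: pairwise_def)
    qed
    then have "infinite (u ` T)" using T(2) finite_imageD by blast
    moreover have "pairwise (\<lambda>z w. \<not> equivalent_points \<Gamma> z w) (u ` T)"
      using T(3) by (auto simp: pairwise_def E_def)
    moreover have "u ` T \<subseteq> {z \<in> upper_half_plane. sphere_map h z = w}"
      using T(1) u upos by (auto simp: uhp H_def)
    ultimately show ?thesis unfolding infinitely_many_inequivalent_def by blast
  qed
  have "{z \<in> upper_half_plane. is_pole h z} = {z \<in> upper_half_plane. sphere_map h z = None}"
    by (auto simp: sphere_map_def)
  with main show ?thesis by simp
qed

end
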